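(* Let $N=S^2$ (respectively $N=H^2$). A Lagrangian congruence $\Sigma\subset TN$ is orthogonal to a minimal surface in $\mathbb{E}^3$ (respectively a maximal surface in $\mathbb{E}^3_1$) without flat points if and only if the congruence is the graph of a local section $\xi\mapsto(\xi,\eta=F(\xi,\bar\xi))$ of $TN\to N$ with $$\frac{\partial}{\partial\bar\xi}\left(\frac{\partial_\xi\bar F}{(1\pm\xi\bar\xi)^2}\right)=0,$$ where the upper sign is for $N=S^2$ and the lower sign for $N=H^2$.
   Context: $\mathbb{E}^3_1$ is $\mathbb{R}^3$ with the flat metric $(dx^1)^2+(dx^2)^2-(dx^3)^2$; write $z=x^1+ix^2$, $t=x^3$ (also on $\mathbb{E}^3$). Upper signs are Euclidean, lower signs Lorentzian. $S^2$ and $H^2$ carry the metrics $g=e^{2u}d\xi d\bar\xi$, $e^{2u}=4(1\pm\xi\bar\xi)^{-2}$ (with $|\xi|<1$ for $H^2$). Write $(\xi,\eta)$ for the tangent vector $\eta\,\partial/\partial\xi+\bar\eta\,\partial/\partial\bar\xi\in T_\xi N$. Points of $TS^2$ (resp. $TH^2$) are identified with oriented lines in $\mathbb{E}^3$ (resp. future-pointing time-like lines in $\mathbb{E}^3_1$): $(\xi,\eta)$ is the line consisting of the points $(z,t)$, $r\in\mathbb{R}$, with $$z=\frac{2(\eta\mp\bar\eta\xi^2)+2\xi(1\pm\xi\bar\xi)r}{(1\pm\xi\bar\xi)^2},\qquad t=\frac{\mp2(\eta\bar\xi+\bar\eta\xi)+(1-\xi^2\bar\xi^2)r}{(1\pm\xi\bar\xi)^2}.$$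 A line congruence is a 2-parameter family of such lines, i.e. a surface $\Sigma\subset TN$. It is Lagrangian if the symplectic form $\Omega=2\,\mathrm{Re}\left(e^{2u}d\eta\wedge d\bar\xi+\eta\,\partial(e^{2u})d\xi\wedge d\bar\xi\right)$ ($\partial=\partial/\partial\xi$) vanishes on $\Sigma$. It is orthogonal to a surface if its lines are the normal lines of that surface. A surface in $\mathbb{E}^3$ is minimal (a space-like surface in $\mathbb{E}^3_1$ is maximal) if its mean curvature vanishes. A flat point of such a surface is a point where both eigenvalues of the second fundamental form are zero.
   Formalization: The section must also satisfy ∂_ξ F̄ ≠ 0 everywhere (F=0, all lines through the origin, refutes the printed "if"); "graph of a local section" is read as locally a graph near each line, in the ξ-coordinate, so for S² lines with ξ=∞ are excluded. *)

theory Defs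
  imports "HOL-Analysis.Analysis"
begin

(* Throughout, the real parameter \<epsilon> is the sign distinguishing the two geometries:
   \<epsilon> = 1 is the Euclidean case (N = S^2), \<epsilon> = -1 the Lorentzian case (N = H^2). *)

text \<open>\<open>C\<^sup>k\<close> and smooth maps on an open set \<open>S\<close>; on sets that are not open the definition is not
  meaningful.\<close>

primrec Ck_on :: "nat \<Rightarrow> 'a::euclidean_space set \<Rightarrow> ('a \<Rightarrow> 'b::real_normed_vector) \<Rightarrow> bool" where
  "Ck_on 0 S f \<longleftrightarrow> continuous_on S f"
| "Ck_on (Suc k) S f \<longleftrightarrow>
     (\<forall>x\<in>S. f differentiable (at x)) \<and> (\<forall>v. Ck_on k S (\<lambda>x. frechet_derivative f (at x) v))"

definition smooth_on :: "'a::euclidean_space set \<Rightarrow> ('a \<Rightarrow> 'b::real_normed_vector) \<Rightarrow> bool" where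
  "smooth_on S f \<longleftrightarrow> (\<forall>k. Ck_on k S f)"

text \<open>The Wirtinger derivatives of a real-differentiable function.\<close>

definition wirt :: "(complex \<Rightarrow> complex) \<Rightarrow> complex \<Rightarrow> complex" where
  "wirt f \<xi> =
     (frechet_derivative f (at \<xi>) 1 - \<i> * frechet_derivative f (at \<xi>) \<i>) / 2"

definition wirt_bar :: "(complex \<Rightarrow> complex) \<Rightarrow> complex \<Rightarrow> complex" where
  "wirt_bar f \<xi> =
     (frechet_derivative f (at \<xi>) 1 + \<i> * frechet_derivative f (at \<xi>) \<i>) / 2"

text \<open>Embedded smooth surfaces (2-dimensional submanifolds without boundary) of a Euclidean
  space. Here \<^typ>\<open>complex\<close> serves as the real parameter plane.\<close>

definition surface_chart ::
  "'a::euclidean_space set \<Rightarrow> complex set \<Rightarrow> (complex \<Rightarrow> 'a) \<Rightarrow> bool" where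
  "surface_chart S U \<phi> \<longleftrightarrow>
     open U \<and> smooth_on U \<phi> \<and> (\<forall>u\<in>U. inj (frechet_derivative \<phi> (at u))) \<and>
     openin (top_of_set S) (\<phi> ` U) \<and> (\<exists>\<psi>. homeomorphism U (\<phi> ` U) \<phi> \<psi>)"

definition embedded_surface :: "'a::euclidean_space set \<Rightarrow> bool" where
  "embedded_surface S \<longleftrightarrow> (\<forall>p\<in>S. \<exists>U \<phi>. surface_chart S U \<phi> \<and> p \<in> \<phi> ` U)"

text \<open>The domain of the coordinate \<open>\<xi>\<close> (for \<open>S\<^sup>2\<close>: all points but the south pole), and the part of
  \<open>TN\<close> over it, where the pair \<open>(\<xi>, \<eta>)\<close> stands for the tangent vector
  \<open>\<eta> \<partial>/\<partial>\<xi> + cnj \<eta> \<partial>/\<partial>(cnj \<xi>)\<close> at \<open>\<xi>\<close>.\<close>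

definition N :: "real \<Rightarrow> complex set" where
  "N \<epsilon> = (if \<epsilon> = 1 then UNIV else {\<xi>. cmod \<xi> < 1})"

definition TN :: "real \<Rightarrow> (complex \<times> complex) set" where
  "TN \<epsilon> = N \<epsilon> \<times> UNIV"

definition e2u :: "real \<Rightarrow> complex \<Rightarrow> complex" where
  "e2u \<epsilon> \<xi> = 4 / (1 + of_real \<epsilon> * \<xi> * cnj \<xi>) ^ 2"

text \<open>The value of
  \<open>2 Re (e\<^sup>2\<^sup>u d\<eta> \<and> d(cnj \<xi>) + \<eta> \<partial>(e\<^sup>2\<^sup>u) d\<xi> \<and> d(cnj \<xi>))\<close> on two tangent vectors \<open>v\<close>, \<open>w\<close> at \<open>p = (\<xi>, \<eta>)\<close>,
  given by their components \<open>(d\<xi>, d\<eta>)\<close>.\<close>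

definition symp ::
  "real \<Rightarrow> complex \<times> complex \<Rightarrow> complex \<times> complex \<Rightarrow> complex \<times> complex \<Rightarrow> real" where
  "symp \<epsilon> p v w =
     2 * Re (e2u \<epsilon> (fst p) * (snd v * cnj (fst w) - snd w * cnj (fst v))
           + snd p * wirt (e2u \<epsilon>) (fst p) * (fst v * cnj (fst w) - fst w * cnj (fst v)))"

definition lagrangian :: "real \<Rightarrow> (complex \<times> complex) set \<Rightarrow> bool" where
  "lagrangian \<epsilon> L \<longleftrightarrow>
     (\<forall>U \<phi>. surface_chart L U \<phi> \<longrightarrow> (\<forall>u\<in>U. \<forall>a b.
        symp \<epsilon> (\<phi> u) (frechet_derivative \<phi> (at u) a) (frechet_derivative \<phi> (at u) b) = 0))"

definition lagrangian_congruence :: "real \<Rightarrow> (complex \<times> complex) set \<Rightarrow> bool" where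
  "lagrangian_congruence \<epsilon> L \<longleftrightarrow>
     embedded_surface L \<and> L \<subseteq> TN \<epsilon> \<and> lagrangian \<epsilon> L"

text \<open>The ambient 3-space consists of the pairs \<open>(z, t)\<close> with \<open>z = x\<^sup>1 + \<i> x\<^sup>2\<close> and \<open>t = x\<^sup>3\<close>; note that
  \<open>z \<bullet> w\<close> is the Euclidean inner product of the plane. The second component of a point of a line
  is real, so taking its real part only changes the type.\<close>

definition amb :: "real \<Rightarrow> complex \<times> real \<Rightarrow> complex \<times> real \<Rightarrow> real" where
  "amb \<epsilon> p q = fst p \<bullet> fst q + \<epsilon> * (snd p * snd q)"

definition line_point :: "real \<Rightarrow> complex \<times> complex \<Rightarrow> real \<Rightarrow> complex \<times> real" where
  "line_point \<epsilon> p r = (let \<xi> = fst p; \<eta> = snd p; e = complex_of_real \<epsilon> in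
     ((2 * (\<eta> - e * cnj \<eta> * \<xi>^2) + 2 * \<xi> * (1 + e * \<xi> * cnj \<xi>) * of_real r)
        / (1 + e * \<xi> * cnj \<xi>) ^ 2,
      Re ((- e * 2 * (\<eta> * cnj \<xi> + cnj \<eta> * \<xi>) + (1 - \<xi>^2 * (cnj \<xi>)^2) * of_real r)
        / (1 + e * \<xi> * cnj \<xi>) ^ 2)))"

definition line_of :: "real \<Rightarrow> complex \<times> complex \<Rightarrow> (complex \<times> real) set" where
  "line_of \<epsilon> p = range (line_point \<epsilon> p)"

text \<open>Local surface theory of a parametrised surface \<open>Y\<close> at the parameter \<open>u\<close>. Tangent vectors are
  represented in the parameter plane, with basis \<open>1, \<i>\<close>. The second fundamental form is taken
  with respect to the unit normal vector \<open>n\<close>.\<close>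

definition first_form :: "real \<Rightarrow> (complex \<Rightarrow> complex \<times> real) \<Rightarrow> complex \<Rightarrow> complex \<Rightarrow> complex \<Rightarrow> real" where
  "first_form \<epsilon> Y u a b =
     amb \<epsilon> (frechet_derivative Y (at u) a) (frechet_derivative Y (at u) b)"

definition unit_normal :: "real \<Rightarrow> (complex \<Rightarrow> complex \<times> real) \<Rightarrow> complex \<Rightarrow> complex \<times> real \<Rightarrow> bool" where
  "unit_normal \<epsilon> Y u n \<longleftrightarrow>
     amb \<epsilon> n n = \<epsilon> \<and> (\<forall>a. amb \<epsilon> n (frechet_derivative Y (at u) a) = 0)"

definition second_form ::
  "real \<Rightarrow> (complex \<Rightarrow> complex \<times> real) \<Rightarrow> complex \<Rightarrow> complex \<times> real \<Rightarrow> complex \<Rightarrow> complex \<Rightarrow> real" where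
  "second_form \<epsilon> Y u n a b =
     amb \<epsilon> (frechet_derivative (\<lambda>w. frechet_derivative Y (at w) b) (at u) a) n"

definition mean_curvature ::
  "real \<Rightarrow> (complex \<Rightarrow> complex \<times> real) \<Rightarrow> complex \<Rightarrow> complex \<times> real \<Rightarrow> real" where
  "mean_curvature \<epsilon> Y u n =
     (let g = first_form \<epsilon> Y u; h = second_form \<epsilon> Y u n in
      (h 1 1 * g \<i> \<i> - 2 * h 1 \<i> * g 1 \<i> + h \<i> \<i> * g 1 1)
        / (2 * (g 1 1 * g \<i> \<i> - (g 1 \<i>)^2)))"

text \<open>Eigenvalues of the second fundamental form relative to the first one, that is, of the
  shape operator.\<close>

definition second_form_eigenvalue ::
  "real \<Rightarrow> (complex \<Rightarrow> complex \<times> real) \<Rightarrow> complex \<Rightarrow> complex \<times> real \<Rightarrow> real \<Rightarrow> bool" where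
  "second_form_eigenvalue \<epsilon> Y u n k \<longleftrightarrow>
     (\<exists>a. a \<noteq> 0 \<and> (\<forall>b. second_form \<epsilon> Y u n a b = k * first_form \<epsilon> Y u a b))"

text \<open>Surfaces in the ambient space may have self-intersections: they are images of immersions
  \<open>X\<close> of a surface \<open>M\<close>. Positivity of the induced metric says that \<open>X\<close> is an immersion and, for
  \<open>\<epsilon> = -1\<close>, that it is space-like. The two choices of unit normal only differ by a sign, which is
  irrelevant below.\<close>

definition immersed_surface ::
  "real \<Rightarrow> 'a::euclidean_space set \<Rightarrow> ('a \<Rightarrow> complex \<times> real) \<Rightarrow> bool" where
  "immersed_surface \<epsilon> M X \<longleftrightarrow> embedded_surface M \<and>
     (\<forall>U \<phi>. surface_chart M U \<phi> \<longrightarrow>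
        smooth_on U (X \<circ> \<phi>) \<and> (\<forall>u\<in>U. \<forall>a. a \<noteq> 0 \<longrightarrow> first_form \<epsilon> (X \<circ> \<phi>) u a a > 0))"

definition zero_mean_curvature ::
  "real \<Rightarrow> 'a::euclidean_space set \<Rightarrow> ('a \<Rightarrow> complex \<times> real) \<Rightarrow> bool" where
  "zero_mean_curvature \<epsilon> M X \<longleftrightarrow>
     (\<forall>U \<phi> u n. surface_chart M U \<phi> \<and> u \<in> U \<and> unit_normal \<epsilon> (X \<circ> \<phi>) u n
        \<longrightarrow> mean_curvature \<epsilon> (X \<circ> \<phi>) u n = 0)"

definition flat_point ::
  "real \<Rightarrow> 'a::euclidean_space set \<Rightarrow> ('a \<Rightarrow> complex \<times> real) \<Rightarrow> 'a \<Rightarrow> bool" where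
  "flat_point \<epsilon> M X p \<longleftrightarrow>
     (\<exists>U \<phi> u n. surface_chart M U \<phi> \<and> u \<in> U \<and> \<phi> u = p \<and> unit_normal \<epsilon> (X \<circ> \<phi>) u n \<and>
        (\<forall>k. second_form_eigenvalue \<epsilon> (X \<circ> \<phi>) u n k \<longrightarrow> k = 0))"

text \<open>The lines of \<open>L\<close> are the normal lines of the surface: \<open>\<nu> p\<close> is the normal line at the point
  \<open>X p\<close>, the continuity of \<open>\<nu>\<close> expressing that the normal lines are consistently oriented.\<close>

definition orthogonal_to ::
  "real \<Rightarrow> (complex \<times> complex) set \<Rightarrow> 'a::euclidean_space set \<Rightarrow> ('a \<Rightarrow> complex \<times> real) \<Rightarrow> bool" where
  "orthogonal_to \<epsilon> L M X \<longleftrightarrow>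
     (\<exists>\<nu>. continuous_on M \<nu> \<and> \<nu> ` M = L \<and> (\<forall>p\<in>M. X p \<in> line_of \<epsilon> (\<nu> p)) \<and>
        (\<forall>U \<phi>. surface_chart M U \<phi> \<longrightarrow>
           (\<forall>u\<in>U. \<forall>a. \<forall>p\<in>line_of \<epsilon> (\<nu> (\<phi> u)). \<forall>q\<in>line_of \<epsilon> (\<nu> (\<phi> u)).
              amb \<epsilon> (p - q) (frechet_derivative (X \<circ> \<phi>) (at u) a) = 0)))"

text \<open>A local section \<open>F\<close> whose graph consists of the normal lines of an immersed minimal (maximal)
  surface has \<open>\<partial>(cnj F)/\<partial>\<xi> \<noteq> 0\<close> everywhere. This is not implied by the holomorphy of \<open>(\<partial>(cnj F)/\<partial>\<xi>) / (1 + \<epsilon> |\<xi>|\<^sup>2)\<^sup>2\<close>: for \<open>F = 0\<close> the lines all pass through the origin, and the surfaces orthogonal to them are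
  pieces of spheres (hyperboloids). Hence the inequation has to accompany that condition.\<close>

definition section_graph :: "complex set \<Rightarrow> (complex \<Rightarrow> complex) \<Rightarrow> (complex \<times> complex) set" where
  "section_graph U F = {(\<xi>, F \<xi>) | \<xi>. \<xi> \<in> U}"

definition local_section :: "real \<Rightarrow> complex set \<Rightarrow> (complex \<Rightarrow> complex) \<Rightarrow> bool" where
  "local_section \<epsilon> U F \<longleftrightarrow> open U \<and> U \<subseteq> N \<epsilon> \<and> smooth_on U F"

end

(* Write w = 1 + \<epsilon>|\<xi>|^2, let n(\<xi>) be the direction vector of the line (\<xi>, \<eta>), and let
   T(\<xi>, v) = dn(v), so that the points of the line are T(\<xi>, \<eta>) + r n(\<xi>). Parametrise a
   surface by its Gauss map: Y(\<xi>) = T(\<xi>, F) + \<rho> n. Then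
   dY(a) = T(\<xi>, B a) + (d\<rho>(a) - 4 \<epsilon> w^-2 Re(F cnj a)) n  with
   B a = dF(a) + (\<rho> - 2 \<epsilon> cnj \<xi> F / w) a. Hence the lines are normal to Y iff
   d\<rho>(a) = 4 \<epsilon> w^-2 Re(F cnj a), the second fundamental form of Y is -4 w^-2 Re(B b cnj a), and
   its trace with respect to the first one vanishes iff B is antilinear, that is, iff
   \<rho> = 2 \<epsilon> cnj \<xi> F / w - \<partial>F; this number is real iff the congruence is Lagrangian. Inserting
   it into the condition on d\<rho> gives the differential equation for F. Conversely it defines a
   surface with B a = (\<partial>F/\<partial>(cnj \<xi>)) cnj a, which is immersed, minimal and not flat.
   A minimal surface without flat points admits its Gauss map as a coordinate: where the derivative
   of the Gauss map degenerates, the second form is degenerate and trace-free, hence zero. *)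

theory Submission
  imports Defs
begin

section \<open>Smooth maps\<close>

text \<open>Why a vanishing trace means antilinearity: the first form is 4 w^-2 Re (B a cnj (B b)),
  so the shape operator is - B^-1, and its trace vanishes together with that of B. Symmetry of the
  second form makes B a symmetric real 2x2 matrix, and the symmetric trace-free matrices are exactly
  the maps a |-> b cnj a.

  Three difficulties lie outside this computation. The hypothesis supplies only a continuous choice
  of normal lines, whereas the Gauss map has to be differentiated and inverted; its smoothness is
  extracted from the vector product of the partial derivatives. A surface yields a section whose
  graph lies in L, but the graph has to fill an open piece of L; this is invariance of domain in a
  chart of L. Conversely, the sections are chosen separately at each line; the height depends only
  on the germ of the section, so the pieces of surface fit together and L itself can serve as the
  parameter surface.\<close>

lemma frechet_derivative_eqI:
  "(f has_derivative f') (at x) \<Longrightarrow> frechet_derivative f (at x) = f'"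
  using frechet_derivative_at by metis

text \<open>Holds also where no derivative exists: \<open>frechet_derivative\<close> is a choice
  from the set of derivatives at x, and this set is the same for f and g.\<close>

lemma frechet_derivative_cong:
  assumes "open S" "x \<in> S" "\<And>y. y \<in> S \<Longrightarrow> f y = g y"
  shows "frechet_derivative f (at x) = frechet_derivative g (at x)"
proof -
  have "(f has_derivative D) (at x) = (g has_derivative D) (at x)" for D
    using has_derivative_transform_within_open[OF _ assms(1,2), of f D UNIV g]
      has_derivative_transform_within_open[OF _ assms(1,2), of g D UNIV f] assms(3) by auto
  then show ?thesis
    unfolding frechet_derivative_def by presburger
qed

lemma Ck_on_cong:
  assumes "open S" "\<And>x. x \<in> S \<Longrightarrow> f x = g x" "Ck_on k S f"
  shows "Ck_on k S g"
  using assms(2,3)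
proof (induction k arbitrary: f g)
  case 0
  then show ?case
    by (metis Ck_on.simps(1) continuous_on_cong)
next
  case (Suc k)
  have "g differentiable at x" if "x \<in> S" for x
  proof -
    have "f differentiable at x"
      using Suc.prems(2) that by simp
    then show ?thesis
      using has_derivative_transform_within_open[OF _ assms(1) that, of f _ UNIV g] Suc.prems(1)
      unfolding differentiable_def by auto
  qed
  moreover have "Ck_on k S (\<lambda>x. frechet_derivative g (at x) v)" for v
  proof (rule Suc.IH)
    show "Ck_on k S (\<lambda>x. frechet_derivative f (at x) v)"
      using Suc.prems by simp
    show "frechet_derivative f (at x) v = frechet_derivative g (at x) v" if "x \<in> S" for x
      using frechet_derivative_cong[OF assms(1) that Suc.prems(1)] by simp
  qed
  ultimately show ?case by simp
qed

lemma Ck_on_SucI: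
  assumes "open S" "\<And>x. x \<in> S \<Longrightarrow> (f has_derivative f' x) (at x)"
    and "\<And>v. Ck_on k S (\<lambda>x. f' x v)"
  shows "Ck_on (Suc k) S f"
proof -
  have "Ck_on k S (\<lambda>x. frechet_derivative f (at x) v)" for v
    by (rule Ck_on_cong[OF assms(1) _ assms(3)[of v]])
       (metis assms(2) frechet_derivative_eqI)
  then show ?thesis
    using assms(2) by (auto simp: differentiable_def)
qed

lemma Ck_on_has_derivative:
  "Ck_on (Suc k) S f \<Longrightarrow> x \<in> S \<Longrightarrow> (f has_derivative frechet_derivative f (at x)) (at x)"
  by (simp add: frechet_derivative_works)

lemma Ck_on_continuous: "Ck_on k S f \<Longrightarrow> continuous_on S f"
  by (cases k) (auto intro: continuous_at_imp_continuous_on differentiable_imp_continuous_within)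

lemma Ck_on_Suc_imp: "Ck_on (Suc k) S f \<Longrightarrow> Ck_on k S f"
proof (induction k arbitrary: f)
  case 0
  then show ?case using Ck_on_continuous[of "Suc 0"] by simp
next
  case (Suc k)
  then show ?case
    by (metis Ck_on.simps(2))
qed

lemma Ck_on_subset: "Ck_on k S f \<Longrightarrow> T \<subseteq> S \<Longrightarrow> Ck_on k T f"
  by (induction k arbitrary: f) (auto intro: continuous_on_subset)

lemma Ck_on_local:
  assumes "\<And>x. x \<in> S \<Longrightarrow> \<exists>T. open T \<and> x \<in> T \<and> Ck_on k T f"
  shows "Ck_on k S f"
  using assms
proof (induction k arbitrary: f)
  case 0
  then show ?case
    by (metis Ck_on.simps(1) continuous_at_imp_continuous_on continuous_on_eq_continuous_at)
next
  case (Suc k)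
  have "Ck_on k S (\<lambda>x. frechet_derivative f (at x) v)" for v
    by (rule Suc.IH) (metis Suc.prems Ck_on.simps(2))
  with Suc.prems show ?case by fastforce
qed

section \<open>Closure of \<open>Ck_on\<close> under algebraic operations, composition and
  inversion\<close>

lemma Ck_on_const: "Ck_on k S (\<lambda>x. c)"
  by (induction k arbitrary: c) auto

lemma Ck_on_bounded_linear_comp:
  assumes "open S" "bounded_linear L" "Ck_on k S f"
  shows "Ck_on k S (\<lambda>x. L (f x))"
  using assms(3)
proof (induction k arbitrary: f)
  case 0
  then show ?case
    using assms(2) by (simp add: linear_continuous_on_compose bounded_linear.linear
        bounded_linear.continuous_on)
next
  case (Suc k)
  show ?case
  proof (rule Ck_on_SucI[OF assms(1)])
    show "((\<lambda>x. L (f x)) has_derivative (\<lambda>v. L (frechet_derivative f (at x) v))) (at x)"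
      if "x \<in> S" for x
      using bounded_linear.has_derivative[OF assms(2)] Ck_on_has_derivative[OF Suc.prems that] .
    show "Ck_on k S (\<lambda>x. L (frechet_derivative f (at x) v))" for v
      using Suc by simp
  qed
qed

lemma Ck_on_bounded_linear:
  assumes "open S" "bounded_linear L"
  shows "Ck_on k S L"
proof (cases k)
  case 0
  then show ?thesis using assms linear_continuous_on by simp
next
  case (Suc m)
  then show ?thesis
    using Ck_on_SucI[OF assms(1) bounded_linear_imp_has_derivative[OF assms(2)] Ck_on_const]
    by blast
qed

lemma Ck_on_add:
  assumes "open S" "Ck_on k S f" "Ck_on k S g"
  shows "Ck_on k S (\<lambda>x. f x + g x)"
  using assms(2,3)
proof (induction k arbitrary: f g)
  case 0
  then show ?case by (simp add: continuous_on_add)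
next
  case (Suc k)
  show ?case
    by (rule Ck_on_SucI[OF assms(1)
          has_derivative_add[OF Ck_on_has_derivative[OF Suc.prems(1)] Ck_on_has_derivative[OF Suc.prems(2)]]])
       (use Suc in auto)
qed

lemma Ck_on_bilinear:
  assumes "open S" "bounded_bilinear B" "Ck_on k S f" "Ck_on k S g"
  shows "Ck_on k S (\<lambda>x. B (f x) (g x))"
  using assms(3,4)
proof (induction k arbitrary: f g)
  case 0
  then show ?case
    using bounded_bilinear.continuous_on[OF assms(2)] by auto
next
  case (Suc k)
  show ?case
  proof (rule Ck_on_SucI[OF assms(1)
          bounded_bilinear.FDERIV[OF assms(2) Ck_on_has_derivative[OF Suc.prems(1)]
            Ck_on_has_derivative[OF Suc.prems(2)]]])
    show "Ck_on k S (\<lambda>x. B (f x) (frechet_derivative g (at x) v)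
        + B (frechet_derivative f (at x) v) (g x))" for v
      by (intro Ck_on_add assms(1) Suc.IH)
         (use Suc.prems Ck_on_Suc_imp in auto)
  qed
qed

lemma Ck_on_sum:
  assumes "open S" "\<And>i. i \<in> I \<Longrightarrow> Ck_on k S (f i)"
  shows "Ck_on k S (\<lambda>x. \<Sum>i\<in>I. f i x)"
proof (cases "finite I")
  case True
  then show ?thesis using assms(2)
    by (induction I) (auto intro: Ck_on_add[OF assms(1)] Ck_on_const)
qed (simp add: Ck_on_const)

lemma Ck_on_inverse:
  fixes f :: "'a::euclidean_space \<Rightarrow> 'b::real_normed_field"
  assumes "open S" "\<And>x. x \<in> S \<Longrightarrow> f x \<noteq> 0" "Ck_on k S f"
  shows "Ck_on k S (\<lambda>x. inverse (f x))"
  using assms(3)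
proof (induction k)
  case 0
  then show ?case using assms(2) by (simp add: continuous_on_inverse)
next
  case (Suc k)
  note IH = Suc.IH[OF Ck_on_Suc_imp[OF Suc.prems]]
  show ?case
  proof (rule Ck_on_SucI[OF assms(1) Deriv.has_derivative_inverse[OF assms(2)
          Ck_on_has_derivative[OF Suc.prems]]])
    have "Ck_on k S (\<lambda>x. (-1) * (inverse (f x) * frechet_derivative f (at x) v * inverse (f x)))" for v
      by (intro Ck_on_bilinear[OF assms(1) bounded_bilinear_mult] Ck_on_const IH)
         (use Suc.prems in simp)
    then show "Ck_on k S (\<lambda>x. - (inverse (f x) * frechet_derivative f (at x) v * inverse (f x)))" for v
      by simp
  qed
qed

lemma Ck_on_compose:
  fixes f :: "'a::euclidean_space \<Rightarrow> 'b::euclidean_space"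
  assumes "open S" "open T" "f ` S \<subseteq> T" "Ck_on k S f" "Ck_on k T g"
  shows "Ck_on k S (\<lambda>x. g (f x))"
  using assms(4,5)
proof (induction k arbitrary: g)
  case 0
  then show ?case
    using continuous_on_compose2[of T g S f] assms(3) by simp
next
  case (Suc k)
  have fT: "f x \<in> T" if "x \<in> S" for x
    using assms(3) that by blast
  \<comment> \<open>Expanding in \<open>Basis\<close> turns the chain rule into a sum of scalars
    times partial derivatives of g at \<open>f x\<close>, so the product rule and the induction
    hypothesis apply to each summand.\<close>
  let ?D = "\<lambda>x v. \<Sum>b\<in>Basis. (frechet_derivative f (at x) v \<bullet> b) *\<^sub>R frechet_derivative g (at (f x)) b"
  show ?case
  proof (rule Ck_on_SucI[OF assms(1)])
    show "((\<lambda>x. g (f x)) has_derivative ?D x) (at x)" if x: "x \<in> S" for x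
    proof -
      have g: "(g has_derivative frechet_derivative g (at (f x))) (at (f x))"
        using Ck_on_has_derivative[OF Suc.prems(2)] fT[OF x] by blast
      have *: "frechet_derivative g (at (f x)) w
          = (\<Sum>b\<in>Basis. (w \<bullet> b) *\<^sub>R frechet_derivative g (at (f x)) b)" for w
      proof -
        have l: "linear (frechet_derivative g (at (f x)))"
          using g has_derivative_linear by blast
        have "frechet_derivative g (at (f x)) w
            = frechet_derivative g (at (f x)) (\<Sum>b\<in>Basis. (w \<bullet> b) *\<^sub>R b)"
          by (simp add: euclidean_representation)
        then show ?thesis
          by (simp add: linear_sum[OF l] linear_cmul[OF l])
      qed
      have "((\<lambda>x. g (f x)) has_derivative
          (\<lambda>v. frechet_derivative g (at (f x)) (frechet_derivative f (at x) v))) (at x)"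
        using has_derivative_compose[OF Ck_on_has_derivative[OF Suc.prems(1) x] g] .
      then show ?thesis
        by (rule has_derivative_eq_rhs) (rule ext, rule *)
    qed
    show "Ck_on k S (\<lambda>x. ?D x v)" for v
    proof (intro Ck_on_sum[OF assms(1)] Ck_on_bilinear[OF assms(1) bounded_bilinear_scaleR])
      fix b :: 'b
      show "Ck_on k S (\<lambda>x. frechet_derivative f (at x) v \<bullet> b)"
        by (rule Ck_on_bounded_linear_comp[OF assms(1) bounded_linear_inner_left])
           (use Suc.prems in simp)
      show "Ck_on k S (\<lambda>x. frechet_derivative g (at (f x)) b)"
        using Suc.IH[OF Ck_on_Suc_imp[OF Suc.prems(1)], of "\<lambda>y. frechet_derivative g (at y) b"]
          Suc.prems(2) by simp
    qed
  qed
qed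

text \<open>Smoothness of a square root needs no choice of a branch once the root is known to be
  continuous.\<close>

lemma Ck_on_continuous_sqrt:
  fixes h :: "'a::euclidean_space \<Rightarrow> real"
  assumes "open S" "continuous_on S h" "\<And>x. x \<in> S \<Longrightarrow> h x \<noteq> 0" "Ck_on k S (\<lambda>x. (h x)\<^sup>2)"
  shows "Ck_on k S h"
  using assms(4)
proof (induction k)
  case 0
  then show ?case using assms(2) by simp
next
  case (Suc k)
  let ?f = "\<lambda>x. (h x)\<^sup>2"
  note IH = Suc.IH[OF Ck_on_Suc_imp[OF Suc.prems]]
  let ?D = "\<lambda>x v. frechet_derivative ?f (at x) v * (inverse (h x) / 2)"
  show ?case
  proof (rule Ck_on_SucI[OF assms(1)])
    fix x assume x: "x \<in> S"
    \<comment> \<open>On T the sign of h is that of \<open>h x\<close>, so h equals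
      \<open>sgn (h x)\<close> times the positive root there.\<close>
    define T where "T = {y \<in> S. h y * h x > 0}"
    have "T = S \<inter> (\<lambda>y. h y * h x) -` {0<..}"
      by (auto simp: T_def)
    then have T: "open T"
      using continuous_open_preimage[OF _ assms(1), of "\<lambda>y. h y * h x" "{0<..}"] assms(2)
      by (simp add: continuous_on_mult_right)
    have xT: "x \<in> T"
      using x assms(3)[OF x] by (simp add: T_def flip: power2_eq_square)
    have "?f x > 0" using assms(3)[OF x] by simp
    moreover have "(?f has_derivative frechet_derivative ?f (at x)) (at x)"
      using Ck_on_has_derivative[OF Suc.prems x] .
    ultimately have "((\<lambda>y. sqrt (?f y)) has_derivative
        (\<lambda>v. frechet_derivative ?f (at x) v * (inverse (sqrt (?f x)) / 2))) (at x)"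
      by (rule DERIV_compose_FDERIV[OF DERIV_real_sqrt])
    from has_derivative_mult_right[OF this, of "sgn (h x)"]
    have "((\<lambda>y. sgn (h x) * sqrt (?f y)) has_derivative ?D x) (at x)"
      by (rule has_derivative_eq_rhs) (auto simp: fun_eq_iff sgn_if field_simps)
    then show "(h has_derivative ?D x) (at x)"
      by (rule has_derivative_transform_within_open[OF _ T xT])
         (auto simp: T_def sgn_if zero_less_mult_iff)
  next
    have "Ck_on k S (\<lambda>x. frechet_derivative ?f (at x) v * (inverse (h x) * (1/2)))" for v
      by (intro Ck_on_bilinear[OF assms(1) bounded_bilinear_mult] Ck_on_const
            Ck_on_inverse[OF assms(1,3)] IH)
         (use Suc.prems in simp)
    then show "Ck_on k S (\<lambda>x. ?D x v)" for v
      by simp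
  qed
qed

text \<open>Bootstrapping: Cramer's rule expresses the derivative of g at y rationally through the
  partial derivatives of f at \<open>g y\<close>, which are k times differentiable as soon as g
  is.\<close>

lemma Ck_on_inverse_function:
  fixes f g :: "complex \<Rightarrow> complex"
  assumes "open U" "open V" "smooth_on U f" "g ` V \<subseteq> U" "continuous_on V g"
    and fg: "\<And>y. y \<in> V \<Longrightarrow> f (g y) = y"
    and der: "\<And>y. y \<in> V \<Longrightarrow> (g has_derivative g' y) (at y)"
  shows "Ck_on k V g"
proof (induction k)
  case 0
  then show ?case using assms(5) by simp
next
  case (Suc k)
  define a where "a = (\<lambda>y. frechet_derivative f (at (g y)) 1)"
  define b where "b = (\<lambda>y. frechet_derivative f (at (g y)) \<i>)"
  have Df: "Ck_on m U (\<lambda>x. frechet_derivative f (at x) v)" for m v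
    using assms(3) unfolding smooth_on_def by (metis Ck_on.simps(2))
  have Ca: "Ck_on k V a" and Cb: "Ck_on k V b"
    unfolding a_def b_def
    by (rule Ck_on_compose[OF assms(2,1,4) Suc.IH Df])+
  \<comment> \<open>The Jacobian determinant of f at \<open>g y\<close>.\<close>
  define J where "J = (\<lambda>y. Im (cnj (a y) * b y))"
  have inv: "f' = (\<lambda>v. Re v *\<^sub>R a y + Im v *\<^sub>R b y) \<and> J y \<noteq> 0 \<and>
      g' y v = Complex (Im (cnj v * b y)) (Im (cnj (a y) * v)) /\<^sub>R J y"
    if y: "y \<in> V" and f': "f' = frechet_derivative f (at (g y))" for y v f'
  proof -
    have "g y \<in> U" using assms(4) y by blast
    then have d: "(f has_derivative f') (at (g y))"
      using assms(3) f' Ck_on_has_derivative unfolding smooth_on_def by blast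
    then have l: "linear f'" using has_derivative_linear by blast
    have f'e: "f' v = Re v *\<^sub>R a y + Im v *\<^sub>R b y" for v
    proof -
      have "f' (Re v *\<^sub>R 1 + Im v *\<^sub>R \<i>) = Re v *\<^sub>R f' 1 + Im v *\<^sub>R f' \<i>"
        by (simp add: linear_add[OF l] linear_cmul[OF l])
      moreover have "Re v *\<^sub>R 1 + Im v *\<^sub>R \<i> = v" by (simp add: complex_eq_iff)
      ultimately show ?thesis by (simp add: a_def b_def f')
    qed
    have "((\<lambda>y. f (g y)) has_derivative (\<lambda>v. f' (g' y v))) (at y)"
      using has_derivative_compose[OF der[OF y] d] .
    moreover have "((\<lambda>y. f (g y)) has_derivative (\<lambda>v. v)) (at y)"
      by (rule has_derivative_transform_within_open[OF has_derivative_ident assms(2) y])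
         (simp add: fg)
    ultimately have id: "f' (g' y v) = v" for v
      by (metis has_derivative_unique)
    have reim: "Re v = Re (g' y v) * Re (a y) + Im (g' y v) * Re (b y)"
      "Im v = Re (g' y v) * Im (a y) + Im (g' y v) * Im (b y)" for v
      using arg_cong[OF id[of v], of Re] arg_cong[OF id[of v], of Im] unfolding f'e by simp_all
    \<comment> \<open>The determinants of v with \<open>a y\<close> and \<open>b y\<close> isolate
      the components of \<open>g' y v\<close>. If \<open>J y\<close> were 0, all of them would
      vanish, and with them \<open>a y\<close> and \<open>b y\<close>, although f' is
      surjective.\<close>
    have r: "Im (cnj (a y) * v) = Im (g' y v) * J y"
      and r2: "Im (cnj v * b y) = Re (g' y v) * J y" for v
      unfolding J_def by (simp_all add: reim[of v] algebra_simps)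
    have "J y \<noteq> 0"
    proof
      assume J0: "J y = 0"
      have "Re (a y) = 0" "Im (a y) = 0" using r[of \<i>] r[of 1] J0 by auto
      moreover have "Re (b y) = 0" "Im (b y) = 0" using r2[of \<i>] r2[of 1] J0 by auto
      ultimately show False using id[of 1] unfolding f'e by (auto simp: complex_eq_iff)
    qed
    with f'e r r2 show ?thesis
      by (auto simp: complex_eq_iff field_simps)
  qed
  have CJ: "Ck_on k V J"
    unfolding J_def
    by (intro Ck_on_bounded_linear_comp[OF assms(2) bounded_linear_Im]
        Ck_on_bilinear[OF assms(2) bounded_bilinear_mult] Ca Cb
        Ck_on_bounded_linear_comp[OF assms(2) bounded_linear_cnj])
  show ?case
  proof (rule Ck_on_SucI[OF assms(2) der])
    fix v
    have "Ck_on k V (\<lambda>y. inverse (J y) *\<^sub>R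
       (complex_of_real (Im (cnj v * b y)) + \<i> * complex_of_real (Im (cnj (a y) * v))))"
      by (intro Ck_on_bounded_linear_comp[OF assms(2) bounded_linear_Im]
        Ck_on_bounded_linear_comp[OF assms(2) bounded_linear_of_real]
        Ck_on_bilinear[OF assms(2) bounded_bilinear_mult] Ca Cb
        Ck_on_bilinear[OF assms(2) bounded_bilinear_scaleR]
        Ck_on_inverse[OF assms(2) _ CJ] Ck_on_const Ck_on_add[OF assms(2)]
        Ck_on_bounded_linear_comp[OF assms(2) bounded_linear_cnj])
       (use inv in blast)
    then show "Ck_on k V (\<lambda>y. g' y v)"
      by (rule Ck_on_cong[OF assms(2), rotated]) (simp add: inv Complex_eq)
  qed
qed

section \<open>Symmetry of second derivatives\<close>

text \<open>The left-hand side does not change when v and w are exchanged, which is what the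
  symmetry proof exploits. The mean value theorem is applied twice: in direction v to the difference
  of two parallel edges, then in direction w to the derivative along v.\<close>

lemma mixed_difference_mean_value:
  fixes f :: "'a::euclidean_space \<Rightarrow> real"
  assumes f: "Ck_on 2 S f" and s: "s > 0"
    and sub: "\<And>a b. 0 \<le> a \<Longrightarrow> a \<le> s \<Longrightarrow> 0 \<le> b \<Longrightarrow> b \<le> s \<Longrightarrow> x + a *\<^sub>R v + b *\<^sub>R w \<in> S"
  shows "\<exists>a\<in>{0..s}. \<exists>b\<in>{0..s}. f (x + s *\<^sub>R v + s *\<^sub>R w) - f (x + s *\<^sub>R v) - f (x + s *\<^sub>R w) + f x
    = s * s * frechet_derivative (\<lambda>y. frechet_derivative f (at y) v) (at (x + a *\<^sub>R v + b *\<^sub>R w)) w"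
proof -
  define D where "D = (\<lambda>y. frechet_derivative f (at y))"
  define H where "H = (\<lambda>y. frechet_derivative (\<lambda>y. D y v) (at y))"
  have f1: "Ck_on (Suc 1) S f" using f by (simp add: numeral_2_eq_2)
  have dD: "(f has_derivative D y) (at y)" if "y \<in> S" for y
    unfolding D_def by (rule Ck_on_has_derivative[OF f1 that])
  have dH: "((\<lambda>y. D y v) has_derivative H y) (at y)" if "y \<in> S" for y
    unfolding H_def D_def
    by (rule Ck_on_has_derivative[OF _ that, of 0]) (use f1 in simp)
  have lin: "D y (c *\<^sub>R z) = c * D y z" "H y (c *\<^sub>R z) = c * H y z" if "y \<in> S" for c y z
    using linear_cmul[OF has_derivative_linear[OF dD[OF that]]]
      linear_cmul[OF has_derivative_linear[OF dH[OF that]]] by simp_all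
  have "\<exists>a\<in>{0..s}. (f (x + s *\<^sub>R v + s *\<^sub>R w) - f (x + s *\<^sub>R v)) - (f (x + 0 *\<^sub>R v + s *\<^sub>R w) - f (x + 0 *\<^sub>R v))
      = D (x + a *\<^sub>R v + s *\<^sub>R w) ((s - 0) *\<^sub>R v) - D (x + a *\<^sub>R v) ((s - 0) *\<^sub>R v)"
  proof (rule mvt_very_simple[where f = "\<lambda>a. f (x + a *\<^sub>R v + s *\<^sub>R w) - f (x + a *\<^sub>R v)"
        and f' = "\<lambda>a h. D (x + a *\<^sub>R v + s *\<^sub>R w) (h *\<^sub>R v) - D (x + a *\<^sub>R v) (h *\<^sub>R v)"])
    show "0 \<le> s" using s by simp
    fix a assume a: "0 \<le> a" "a \<le> s"
    have m: "x + a *\<^sub>R v + s *\<^sub>R w \<in> S" "x + a *\<^sub>R v \<in> S"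
      using sub[of a s] sub[of a 0] a s by auto
    have l: "((\<lambda>a. x + a *\<^sub>R v + s *\<^sub>R w) has_derivative (\<lambda>h. h *\<^sub>R v)) (at a within {0..s})"
      "((\<lambda>a. x + a *\<^sub>R v) has_derivative (\<lambda>h. h *\<^sub>R v)) (at a within {0..s})"
      by (auto intro!: derivative_eq_intros)
    show "((\<lambda>a. f (x + a *\<^sub>R v + s *\<^sub>R w) - f (x + a *\<^sub>R v)) has_derivative
        (\<lambda>h. D (x + a *\<^sub>R v + s *\<^sub>R w) (h *\<^sub>R v) - D (x + a *\<^sub>R v) (h *\<^sub>R v))) (at a within {0..s})"
      by (rule has_derivative_diff[OF has_derivative_compose[OF l(1) dD[OF m(1)]]
            has_derivative_compose[OF l(2) dD[OF m(2)]]])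
  qed
  then obtain a where a: "0 \<le> a" "a \<le> s" and
    ea: "(f (x + s *\<^sub>R v + s *\<^sub>R w) - f (x + s *\<^sub>R v)) - (f (x + s *\<^sub>R w) - f x)
      = D (x + a *\<^sub>R v + s *\<^sub>R w) (s *\<^sub>R v) - D (x + a *\<^sub>R v) (s *\<^sub>R v)"
    by auto
  have "\<exists>b\<in>{0..s}. D (x + a *\<^sub>R v + s *\<^sub>R w) v - D (x + a *\<^sub>R v + 0 *\<^sub>R w) v
      = H (x + a *\<^sub>R v + b *\<^sub>R w) ((s - 0) *\<^sub>R w)"
  proof (rule mvt_very_simple[where f = "\<lambda>b. D (x + a *\<^sub>R v + b *\<^sub>R w) v"
        and f' = "\<lambda>b h. H (x + a *\<^sub>R v + b *\<^sub>R w) (h *\<^sub>R w)"])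
    show "0 \<le> s" using s by simp
    fix b assume b: "0 \<le> b" "b \<le> s"
    have l: "((\<lambda>b. x + a *\<^sub>R v + b *\<^sub>R w) has_derivative (\<lambda>h. h *\<^sub>R w)) (at b within {0..s})"
      by (auto intro!: derivative_eq_intros)
    show "((\<lambda>b. D (x + a *\<^sub>R v + b *\<^sub>R w) v) has_derivative
        (\<lambda>h. H (x + a *\<^sub>R v + b *\<^sub>R w) (h *\<^sub>R w))) (at b within {0..s})"
      by (rule has_derivative_compose[OF l dH[OF sub[OF a b]]])
  qed
  then obtain b where b: "0 \<le> b" "b \<le> s" and
    eb: "D (x + a *\<^sub>R v + s *\<^sub>R w) v - D (x + a *\<^sub>R v) v = H (x + a *\<^sub>R v + b *\<^sub>R w) (s *\<^sub>R w)"
    by auto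
  have "x + a *\<^sub>R v + s *\<^sub>R w \<in> S" "x + a *\<^sub>R v \<in> S" "x + a *\<^sub>R v + b *\<^sub>R w \<in> S"
    using sub[of a s] sub[of a 0] sub[of a b] a b s by auto
  with ea eb have "f (x + s *\<^sub>R v + s *\<^sub>R w) - f (x + s *\<^sub>R v) - f (x + s *\<^sub>R w) + f x
      = s * (s * H (x + a *\<^sub>R v + b *\<^sub>R w) w)"
    by (simp add: lin flip: right_diff_distrib)
  with a b show ?thesis
    unfolding H_def D_def by (intro bexI[of _ a] bexI[of _ b]) auto
qed

text \<open>Both mixed derivatives, taken at suitable points of a small parallelogram at x, equal
  the same second difference divided by s^2; continuity at x does the rest.\<close>

lemma symmetric_second_derivative_real:
  fixes f :: "'a::euclidean_space \<Rightarrow> real"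
  assumes "open S" "x \<in> S" and f: "Ck_on 2 S f"
  shows "frechet_derivative (\<lambda>y. frechet_derivative f (at y) v) (at x) w
    = frechet_derivative (\<lambda>y. frechet_derivative f (at y) w) (at x) v"
proof -
  define H where "H = (\<lambda>v w y. frechet_derivative (\<lambda>y. frechet_derivative f (at y) v) (at y) w)"
  have cont: "continuous (at x) (H v w)" for v w
    using f assms(1,2) unfolding H_def
    by (simp add: numeral_2_eq_2 continuous_on_eq_continuous_at)
  have "\<bar>H v w x - H w v x\<bar> \<le> e" if e: "e > 0" for e
  proof -
    obtain d1 where d1: "d1 > 0" "\<And>y. dist y x < d1 \<Longrightarrow> \<bar>H v w y - H v w x\<bar> < e / 2"
      using cont[of v w] e unfolding continuous_at_eps_delta dist_real_def
      by (meson half_gt_zero)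
    obtain d2 where d2: "d2 > 0" "\<And>y. dist y x < d2 \<Longrightarrow> \<bar>H w v y - H w v x\<bar> < e / 2"
      using cont[of w v] e unfolding continuous_at_eps_delta dist_real_def
      by (meson half_gt_zero)
    obtain d3 where d3: "d3 > 0" "ball x d3 \<subseteq> S"
      using assms(1,2) open_contains_ball by blast
    define d where "d = min d1 (min d2 d3)"
    \<comment> \<open>Small enough for the parallelogram spanned by s v and s w to stay within
      distance d of x; the summand 1 keeps the denominator positive when v = w = 0.\<close>
    define s where "s = d / (2 * (norm v + norm w + 1))"
    have dpos: "d > 0" using d1 d2 d3 by (simp add: d_def)
    have n: "norm v + norm w + 1 > 0" using norm_ge_zero[of v] norm_ge_zero[of w] by linarith
    have spos: "s > 0" using dpos n by (simp add: s_def)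
    have near: "dist (x + a *\<^sub>R p + b *\<^sub>R q) x < d"
      if "0 \<le> a" "a \<le> s" "0 \<le> b" "b \<le> s" "{p, q} = {v, w}" for a b p q
    proof -
      have "norm (a *\<^sub>R p + b *\<^sub>R q) \<le> s * norm p + s * norm q"
        by (rule order_trans[OF norm_triangle_ineq]) (use that in \<open>auto intro!: add_mono mult_right_mono\<close>)
      also have "\<dots> = s * (norm v + norm w)"
        using that(5) by (auto simp: doubleton_eq_iff algebra_simps)
      also have "\<dots> < s * (2 * (norm v + norm w + 1))"
        by (rule mult_strict_left_mono[OF _ spos]) (use n in \<open>simp add: algebra_simps\<close>)
      also have "\<dots> = d" using n by (simp add: s_def)
      finally show ?thesis by (simp add: dist_norm add.assoc)
    qed
    have inS: "x + a *\<^sub>R p + b *\<^sub>R q \<in> S"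
      if "0 \<le> a" "a \<le> s" "0 \<le> b" "b \<le> s" "{p, q} = {v, w}" for a b p q
      using near[OF that] d3(2) by (auto simp: d_def dist_commute)
    obtain a b where ab: "a \<in> {0..s}" "b \<in> {0..s}" and
      e1: "f (x + s *\<^sub>R v + s *\<^sub>R w) - f (x + s *\<^sub>R v) - f (x + s *\<^sub>R w) + f x
        = s * s * H v w (x + a *\<^sub>R v + b *\<^sub>R w)"
      using mixed_difference_mean_value[OF f spos, of x v w] inS unfolding H_def by blast
    obtain a' b' where ab': "a' \<in> {0..s}" "b' \<in> {0..s}" and
      e2: "f (x + s *\<^sub>R w + s *\<^sub>R v) - f (x + s *\<^sub>R w) - f (x + s *\<^sub>R v) + f x
        = s * s * H w v (x + a' *\<^sub>R w + b' *\<^sub>R v)"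
      using mixed_difference_mean_value[OF f spos, of x w v] inS unfolding H_def by blast
    have "f (x + s *\<^sub>R w + s *\<^sub>R v) = f (x + s *\<^sub>R v + s *\<^sub>R w)"
      by (simp add: add.commute add.left_commute)
    with e1 e2 have "s * s * H v w (x + a *\<^sub>R v + b *\<^sub>R w) = s * s * H w v (x + a' *\<^sub>R w + b' *\<^sub>R v)"
      by linarith
    with spos have "H v w (x + a *\<^sub>R v + b *\<^sub>R w) = H w v (x + a' *\<^sub>R w + b' *\<^sub>R v)"
      by simp
    moreover have "\<bar>H v w (x + a *\<^sub>R v + b *\<^sub>R w) - H v w x\<bar> < e / 2"
      by (rule d1(2)) (use near[of a b v w] ab in \<open>auto simp: d_def\<close>)
    moreover have "\<bar>H w v (x + a' *\<^sub>R w + b' *\<^sub>R v) - H w v x\<bar> < e / 2"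
      by (rule d2(2)) (use near[of a' b' w v] ab' in \<open>auto simp: d_def insert_commute\<close>)
    ultimately show ?thesis by linarith
  qed
  then have "\<bar>H v w x - H w v x\<bar> \<le> 0"
    by (rule field_le_epsilon) simp
  then show ?thesis by (simp add: H_def)
qed

lemma symmetric_second_derivative:
  fixes f :: "'a::euclidean_space \<Rightarrow> 'b::euclidean_space"
  assumes "open S" "x \<in> S" and f: "Ck_on 2 S f"
  shows "frechet_derivative (\<lambda>y. frechet_derivative f (at y) v) (at x) w
    = frechet_derivative (\<lambda>y. frechet_derivative f (at y) w) (at x) v"
proof (rule euclidean_eqI)
  fix b :: 'b
  have f1: "Ck_on (Suc 1) S f" using f by (simp add: numeral_2_eq_2)
  let ?g = "\<lambda>y. f y \<bullet> b"
  have g: "frechet_derivative ?g (at y) u = frechet_derivative f (at y) u \<bullet> b" if "y \<in> S" for y u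
    by (simp add: frechet_derivative_eqI[OF has_derivative_inner_left[OF Ck_on_has_derivative[OF f1 that]]])
  have "frechet_derivative (\<lambda>y. frechet_derivative ?g (at y) u) (at x) z
      = frechet_derivative (\<lambda>y. frechet_derivative f (at y) u) (at x) z \<bullet> b" for u z
  proof -
    have "((\<lambda>y. frechet_derivative f (at y) u) has_derivative
        frechet_derivative (\<lambda>y. frechet_derivative f (at y) u) (at x)) (at x)"
      by (rule Ck_on_has_derivative[OF _ assms(2), of 0]) (use f1 in simp)
    from frechet_derivative_eqI[OF has_derivative_inner_left[OF this, of b]]
    have "frechet_derivative (\<lambda>y. frechet_derivative f (at y) u \<bullet> b) (at x) z
      = frechet_derivative (\<lambda>y. frechet_derivative f (at y) u) (at x) z \<bullet> b"
      by simp
    moreover have "frechet_derivative (\<lambda>y. frechet_derivative ?g (at y) u) (at x)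
       = frechet_derivative (\<lambda>y. frechet_derivative f (at y) u \<bullet> b) (at x)"
      by (rule frechet_derivative_cong[OF assms(1,2) g])
    ultimately show ?thesis by simp
  qed
  moreover have "Ck_on 2 S ?g"
    by (rule Ck_on_bounded_linear_comp[OF assms(1) bounded_linear_inner_left f])
  ultimately show "frechet_derivative (\<lambda>y. frechet_derivative f (at y) v) (at x) w \<bullet> b
    = frechet_derivative (\<lambda>y. frechet_derivative f (at y) w) (at x) v \<bullet> b"
    using symmetric_second_derivative_real[OF assms(1,2), of ?g v w] by simp
qed

section \<open>Closure rules for smooth maps and the smooth inverse function theorem\<close>

lemma smooth_on_cong: "open S \<Longrightarrow> smooth_on S f \<Longrightarrow> (\<And>x. x \<in> S \<Longrightarrow> f x = g x) \<Longrightarrow> smooth_on S g"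
  unfolding smooth_on_def using Ck_on_cong by blast

lemma smooth_on_local:
  "(\<And>x. x \<in> S \<Longrightarrow> \<exists>T. open T \<and> x \<in> T \<and> smooth_on T f) \<Longrightarrow> smooth_on S f"
  unfolding smooth_on_def using Ck_on_local by metis

lemma smooth_on_subset: "smooth_on S f \<Longrightarrow> T \<subseteq> S \<Longrightarrow> smooth_on T f"
  unfolding smooth_on_def using Ck_on_subset by blast

lemma smooth_on_continuous: "smooth_on S f \<Longrightarrow> continuous_on S f"
  unfolding smooth_on_def using Ck_on_continuous by blast

lemma smooth_on_has_derivative:
  "smooth_on S f \<Longrightarrow> x \<in> S \<Longrightarrow> (f has_derivative frechet_derivative f (at x)) (at x)"
  unfolding smooth_on_def using Ck_on_has_derivative by blast

lemma smooth_on_frechet_derivative: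
  "smooth_on S f \<Longrightarrow> smooth_on S (\<lambda>x. frechet_derivative f (at x) v)"
  unfolding smooth_on_def by (metis Ck_on.simps(2))

lemma smooth_on_compose:
  fixes f :: "'a::euclidean_space \<Rightarrow> 'b::euclidean_space"
  shows "open S \<Longrightarrow> open T \<Longrightarrow> f ` S \<subseteq> T \<Longrightarrow> smooth_on S f \<Longrightarrow> smooth_on T g
    \<Longrightarrow> smooth_on S (\<lambda>x. g (f x))"
  unfolding smooth_on_def using Ck_on_compose by blast

lemma smooth_on_const: "smooth_on S (\<lambda>x. c)"
  unfolding smooth_on_def using Ck_on_const by blast

lemma smooth_on_ident: "open S \<Longrightarrow> smooth_on S (\<lambda>x. x)"
  unfolding smooth_on_def using Ck_on_bounded_linear bounded_linear_ident by blast

lemma smooth_on_add: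
  "open S \<Longrightarrow> smooth_on S f \<Longrightarrow> smooth_on S g \<Longrightarrow> smooth_on S (\<lambda>x. f x + g x)"
  unfolding smooth_on_def using Ck_on_add by blast

lemma smooth_on_linear:
  assumes "bounded_linear L" "open S" "smooth_on S f"
  shows "smooth_on S (\<lambda>x. L (f x))"
  using assms unfolding smooth_on_def using Ck_on_bounded_linear_comp by blast

lemma smooth_on_bilinear:
  assumes "bounded_bilinear B" "open S" "smooth_on S f" "smooth_on S g"
  shows "smooth_on S (\<lambda>x. B (f x) (g x))"
  using assms unfolding smooth_on_def using Ck_on_bilinear by blast

lemma smooth_on_minus: "open S \<Longrightarrow> smooth_on S f \<Longrightarrow> smooth_on S (\<lambda>x. - f x)"
  by (rule smooth_on_linear[OF bounded_linear_minus[OF bounded_linear_ident]])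

lemma smooth_on_diff:
  "open S \<Longrightarrow> smooth_on S f \<Longrightarrow> smooth_on S g \<Longrightarrow> smooth_on S (\<lambda>x. f x - g x)"
  using smooth_on_add[OF _ _ smooth_on_minus] by force

lemma smooth_on_inverse:
  fixes f :: "'a::euclidean_space \<Rightarrow> 'b::real_normed_field"
  shows "open S \<Longrightarrow> smooth_on S f \<Longrightarrow> (\<And>x. x \<in> S \<Longrightarrow> f x \<noteq> 0) \<Longrightarrow> smooth_on S (\<lambda>x. inverse (f x))"
  unfolding smooth_on_def using Ck_on_inverse by blast

lemma smooth_on_divide:
  fixes f g :: "'a::euclidean_space \<Rightarrow> 'b::real_normed_field"
  assumes "open S" "smooth_on S f" "smooth_on S g" "\<And>x. x \<in> S \<Longrightarrow> g x \<noteq> 0"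
  shows "smooth_on S (\<lambda>x. f x / g x)"
  using smooth_on_bilinear[OF bounded_bilinear_mult assms(1,2) smooth_on_inverse[OF assms(1,3,4)]]
  by (simp add: divide_inverse)

lemma smooth_on_power:
  fixes f :: "'a::euclidean_space \<Rightarrow> 'b::real_normed_field"
  assumes "open S" "smooth_on S f"
  shows "smooth_on S (\<lambda>x. f x ^ n)"
proof (induction n)
  case 0
  then show ?case by (simp add: smooth_on_const)
next
  case (Suc n)
  then show ?case
    using smooth_on_bilinear[OF bounded_bilinear_mult assms(1,2) Suc] by simp
qed

lemma smooth_on_Pair:
  assumes "open S" "smooth_on S f" "smooth_on S g"
  shows "smooth_on S (\<lambda>x. (f x, g x))"
proof -
  have "bounded_linear (\<lambda>y. (y, 0))" "bounded_linear (\<lambda>y. (0, y))"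
    by (auto intro: bounded_linear_Pair bounded_linear_ident bounded_linear_zero)
  from smooth_on_add[OF assms(1) smooth_on_linear[OF this(1) assms(1,2)]
      smooth_on_linear[OF this(2) assms(1,3)]]
  show ?thesis by simp
qed

lemma smooth_on_wirt:
  assumes "open S" "smooth_on S f"
  shows "smooth_on S (wirt f)"
proof -
  have "smooth_on S (\<lambda>x. (1 / 2) * (frechet_derivative f (at x) 1 - \<i> * frechet_derivative f (at x) \<i>))"
    by (intro smooth_on_bilinear[OF bounded_bilinear_mult] smooth_on_const smooth_on_diff assms
        smooth_on_frechet_derivative)
  then show ?thesis
    by (rule smooth_on_cong[OF assms(1)]) (simp add: wirt_def)
qed

lemmas smooth_intros =
  smooth_on_const smooth_on_ident smooth_on_add smooth_on_diff smooth_on_minus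
  smooth_on_power smooth_on_Pair smooth_on_divide smooth_on_wirt
  smooth_on_bilinear[OF bounded_bilinear_mult]
  smooth_on_bilinear[OF bounded_bilinear_scaleR]
  smooth_on_bilinear[OF bounded_bilinear_inner]
  smooth_on_linear[OF bounded_linear_cnj]
  smooth_on_linear[OF bounded_linear_Re]
  smooth_on_linear[OF bounded_linear_Im]
  smooth_on_linear[OF bounded_linear_fst]
  smooth_on_linear[OF bounded_linear_snd]
  smooth_on_linear[OF bounded_linear_of_real]

text \<open>The C^1 theorem produces g together with its derivative;
  \<open>Ck_on_inverse_function\<close> raises the regularity.\<close>

lemma smooth_inverse_function:
  fixes f :: "complex \<Rightarrow> complex"
  assumes "open U" "smooth_on U f" "u \<in> U" "inj (frechet_derivative f (at u))"
  obtains U' V g where "open U'" "U' \<subseteq> U" "u \<in> U'" "open V" "homeomorphism U' V f g"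
    "smooth_on V g" "\<And>y. y \<in> V \<Longrightarrow> inj (frechet_derivative g (at y))"
proof -
  \<comment> \<open>\<open>inverse_function_theorem\<close> takes the derivative as a continuous map
    into the bounded linear maps; in finite dimension continuity may be tested on each
    vector.\<close>
  define f' where "f' = (\<lambda>x. Blinfun (frechet_derivative f (at x)))"
  have d: "(f has_derivative frechet_derivative f (at x)) (at x)" if "x \<in> U" for x
    using smooth_on_has_derivative[OF assms(2) that] .
  have ap: "blinfun_apply (f' x) = frechet_derivative f (at x)" if "x \<in> U" for x
    unfolding f'_def by (rule bounded_linear_Blinfun_apply[OF has_derivative_bounded_linear[OF d[OF that]]])
  have c: "continuous_on U f'"
  proof (rule continuous_on_blinfun_componentwise)
    fix i :: complex
    show "continuous_on U (\<lambda>x. blinfun_apply (f' x) i)"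
      using smooth_on_continuous[OF smooth_on_frechet_derivative[OF assms(2)]]
      by (rule continuous_on_eq) (simp add: ap)
  qed
  have lu: "linear (frechet_derivative f (at u))"
    using d[OF assms(3)] has_derivative_linear by blast
  obtain h where h: "linear h" "h \<circ> frechet_derivative f (at u) = id"
    using linear_injective_left_inverse[OF lu assms(4)] by blast
  have inv: "Blinfun h o\<^sub>L f' u = id_blinfun"
  proof (rule blinfun_eqI)
    fix i
    have "blinfun_apply (Blinfun h) = h"
      using h(1) by (simp add: bounded_linear_Blinfun_apply linear_conv_bounded_linear)
    then show "blinfun_apply (Blinfun h o\<^sub>L f' u) i = blinfun_apply id_blinfun i"
      using h(2) ap[OF assms(3)] by (simp add: fun_eq_iff)
  qed
  have d2: "(f has_derivative blinfun_apply (f' x)) (at x)" if "x \<in> U" for x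
    using d[OF that] ap[OF that] by simp
  obtain U' V g g' where g: "open U'" "U' \<subseteq> U" "u \<in> U'" "open V" "homeomorphism U' V f g"
    "\<And>y. y \<in> V \<Longrightarrow> (g has_derivative g' y) (at y)"
    "\<And>y. y \<in> V \<Longrightarrow> g' y = inv (blinfun_apply (f' (g y)))"
    "\<And>y. y \<in> V \<Longrightarrow> bij (blinfun_apply (f' (g y)))"
    using inverse_function_theorem[OF assms(1) d2 c assms(3) inv] by metis
  show ?thesis
  proof
    have gV: "g ` V \<subseteq> U" "continuous_on V g" and fg: "\<And>y. y \<in> V \<Longrightarrow> f (g y) = y"
      using g(2,5) unfolding homeomorphism_def by auto
    show "smooth_on V g"
      using Ck_on_inverse_function[OF assms(1) g(4) assms(2) gV fg g(6)]
      unfolding smooth_on_def by blast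
    show "inj (frechet_derivative g (at y))" if "y \<in> V" for y
      using frechet_derivative_eqI[OF g(6)[OF that]] g(7,8)[OF that]
      by (metis bij_imp_bij_inv bij_is_inj)
  qed (use g in auto)
qed

section \<open>The moving frame of the space of lines\<close>

locale sign =
  fixes \<epsilon> :: real
  assumes sign: "\<epsilon> = 1 \<or> \<epsilon> = -1"
begin

lemma sign_sq: "\<epsilon> * \<epsilon> = 1"
  using sign by auto

text \<open>The factor w as a real number; \<open>e2u\<close> is 4 / w^2.\<close>

definition conf :: "complex \<Rightarrow> real" where
  "conf \<xi> = 1 + \<epsilon> * (\<xi> \<bullet> \<xi>)"

text \<open>The direction vector of the lines over \<open>\<xi>\<close>; its derivative is \<open>tang \<xi>\<close>.\<close>

definition dir :: "complex \<Rightarrow> complex \<times> real" where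
  "dir \<xi> = (2 / conf \<xi>) *\<^sub>R (\<xi>, 1) - (0, 1)"

definition tang :: "complex \<Rightarrow> complex \<Rightarrow> complex \<times> real" where
  "tang \<xi> v = (2 / conf \<xi>) *\<^sub>R (v, 0) - (4 * \<epsilon> / (conf \<xi>)\<^sup>2 * (\<xi> \<bullet> v)) *\<^sub>R (\<xi>, 1)"

lemma conf_complex: "complex_of_real (conf \<xi>) = 1 + complex_of_real \<epsilon> * \<xi> * cnj \<xi>"
  by (simp add: conf_def complex_eq_iff inner_complex_def algebra_simps)

lemma conf_pos: "\<xi> \<in> N \<epsilon> \<Longrightarrow> conf \<xi> > 0"
  using sign by (auto simp: conf_def N_def dot_square_norm power_less_one_iff
      intro: add_pos_nonneg split: if_splits)

text \<open>The coordinate formula of a line in terms of the frame. The point with r = 0 is the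
  tangent vector \<eta> of N realised in the ambient space; by \<open>amb_tang_dir\<close> it is the
  point of the line orthogonal to its direction.\<close>

lemma line_point_eq:
  assumes "conf (fst p) \<noteq> 0"
  shows "line_point \<epsilon> p r = tang (fst p) (snd p) + r *\<^sub>R dir (fst p)"
proof -
  obtain x y where x: "fst p = Complex x y" by (cases "fst p")
  obtain a b where a: "snd p = Complex a b" by (cases "snd p")
  define c where "c = conf (fst p)"
  have c: "c = 1 + \<epsilon> * (x * x + y * y)" "c \<noteq> 0"
    using assms by (simp_all add: c_def conf_def x inner_complex_def)
  have 1: "1 + complex_of_real \<epsilon> * fst p * cnj (fst p) = complex_of_real c"
    by (simp add: conf_complex c_def)
  have ip: "fst p \<bullet> snd p = x * a + y * b"
    by (simp add: x a inner_complex_def)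
  have ee: "\<epsilon> * \<epsilon> = 1" by (rule sign_sq)
  have "(2 * (a - \<epsilon> * ((x * x - y * y) * a + 2 * x * y * b)) + 2 * x * c * r) / c\<^sup>2
      = 2 / c * a - 4 * \<epsilon> / c\<^sup>2 * (x * a + y * b) * x + r * (2 / c * x)"
    using c(2) by (simp add: field_simps power2_eq_square) (use c(1) in algebra)
  moreover have "(2 * (b - \<epsilon> * (2 * x * y * a - (x * x - y * y) * b)) + 2 * y * c * r) / c\<^sup>2
      = 2 / c * b - 4 * \<epsilon> / c\<^sup>2 * (x * a + y * b) * y + r * (2 / c * y)"
    using c(2) by (simp add: field_simps power2_eq_square) (use c(1) in algebra)
  moreover have "(- \<epsilon> * 2 * (2 * (x * a + y * b)) + (1 - (x * x + y * y)\<^sup>2) * r) / c\<^sup>2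
      = - (4 * \<epsilon> / c\<^sup>2 * (x * a + y * b)) + r * (2 / c - 1)"
    using c(2) by (simp add: field_simps power2_eq_square) (use c(1) ee in algebra)
  moreover have "line_point \<epsilon> p r = (Complex
      ((2 * (a - \<epsilon> * ((x * x - y * y) * a + 2 * x * y * b)) + 2 * x * c * r) / c\<^sup>2)
      ((2 * (b - \<epsilon> * (2 * x * y * a - (x * x - y * y) * b)) + 2 * y * c * r) / c\<^sup>2),
      (- \<epsilon> * 2 * (2 * (x * a + y * b)) + (1 - (x * x + y * y)\<^sup>2) * r) / c\<^sup>2)"
    unfolding line_point_def Let_def 1 
    unfolding x a
    by (simp add: complex_eq_iff power2_eq_square flip: of_real_mult)
       (simp add: algebra_simps)
  ultimately show ?thesis
    unfolding tang_def dir_def ip c_def[symmetric] unfolding x a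
    by (simp add: complex_eq_iff)
qed

section \<open>The ambient form in the moving frame\<close>

lemma bounded_bilinear_amb: "bounded_bilinear (amb \<epsilon>)"
proof -
  have "bounded_linear (\<lambda>p::complex \<times> real. (fst p, \<epsilon> * snd p))"
    by (intro bounded_linear_intros)
  then have "bounded_bilinear (\<lambda>p q::complex \<times> real. p \<bullet> (fst q, \<epsilon> * snd q))"
    by (rule bounded_bilinear.comp[OF bounded_bilinear_inner bounded_linear_ident])
  moreover have "amb \<epsilon> = (\<lambda>p q. p \<bullet> (fst q, \<epsilon> * snd q))"
    by (auto simp: amb_def fun_eq_iff inner_prod_def)
  ultimately show ?thesis by simp
qed

lemma amb_commute: "amb \<epsilon> p q = amb \<epsilon> q p"
  by (simp add: amb_def inner_commute mult.commute)

lemmas amb_simps =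
  bounded_bilinear.add_left[OF bounded_bilinear_amb]
  bounded_bilinear.add_right[OF bounded_bilinear_amb]
  bounded_bilinear.diff_left[OF bounded_bilinear_amb]
  bounded_bilinear.diff_right[OF bounded_bilinear_amb]
  bounded_bilinear.minus_left[OF bounded_bilinear_amb]
  bounded_bilinear.minus_right[OF bounded_bilinear_amb]
  bounded_bilinear.zero_left[OF bounded_bilinear_amb]
  bounded_bilinear.zero_right[OF bounded_bilinear_amb]
  bounded_bilinear.scaleR_left[OF bounded_bilinear_amb]
  bounded_bilinear.scaleR_right[OF bounded_bilinear_amb]

text \<open>With r = 1 / w the frame has polynomial entries in r and the coordinates, so identities
  between them follow by \<open>algebra\<close> from r + \<epsilon> |\<xi>|^2 r = 1 and \<epsilon>^2
  = 1.\<close>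

lemma frame_eqs:
  assumes "conf \<xi> \<noteq> 0"
  obtains r where "dir \<xi> = (2 * r) *\<^sub>R (\<xi>, 1) - (0, 1)"
    "\<And>v. tang \<xi> v = (2 * r) *\<^sub>R (v, 0) - (4 * \<epsilon> * r\<^sup>2 * (\<xi> \<bullet> v)) *\<^sub>R (\<xi>, 1)"
    "r * conf \<xi> = 1" "r + \<epsilon> * (\<xi> \<bullet> \<xi>) * r = 1" "r = 1 / conf \<xi>"
proof (rule that[of "1 / conf \<xi>"])
  show "1 / conf \<xi> * conf \<xi> = 1" using assms by simp
  then show "1 / conf \<xi> + \<epsilon> * (\<xi> \<bullet> \<xi>) * (1 / conf \<xi>) = 1"
    unfolding conf_def by algebra
qed (simp_all add: dir_def tang_def power_divide)

lemma amb_dir_dir: assumes "conf \<xi> \<noteq> 0" shows "amb \<epsilon> (dir \<xi>) (dir \<xi>) = \<epsilon>"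
proof -
  obtain r where r: "dir \<xi> = (2 * r) *\<^sub>R (\<xi>, 1) - (0, 1)" "r + \<epsilon> * (\<xi> \<bullet> \<xi>) * r = 1"
    using frame_eqs[OF assms] .
  \<comment> \<open>The inner product is generalised to a variable X, which leaves an identity
    between real polynomials.\<close>
  have "4 * r * r * X + \<epsilon> * ((2 * r - 1) * (2 * r - 1)) = \<epsilon>"
    if "r + \<epsilon> * X * r = 1" for X
    using that sign_sq by algebra
  from this[OF r(2)] show ?thesis
    by (simp add: amb_def r(1))
qed

lemma amb_tang_dir: assumes "conf \<xi> \<noteq> 0" shows "amb \<epsilon> (tang \<xi> v) (dir \<xi>) = 0"
proof -
  obtain r where r: "dir \<xi> = (2 * r) *\<^sub>R (\<xi>, 1) - (0, 1)"
    "\<And>v. tang \<xi> v = (2 * r) *\<^sub>R (v, 0) - (4 * \<epsilon> * r\<^sup>2 * (\<xi> \<bullet> v)) *\<^sub>R (\<xi>, 1)"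
    "r + \<epsilon> * (\<xi> \<bullet> \<xi>) * r = 1"
    using frame_eqs[OF assms] by metis
  have "2 * r * (2 * r * p - 4 * \<epsilon> * r\<^sup>2 * p * X) + \<epsilon> * (- (4 * \<epsilon> * r\<^sup>2 * p) * (2 * r - 1)) = 0"
    if "r + \<epsilon> * X * r = 1" for X p
    using that sign_sq by algebra
  from this[OF r(3), of "\<xi> \<bullet> v"]
  have "2 * r * (2 * r * (\<xi> \<bullet> v) - 4 * \<epsilon> * r\<^sup>2 * (\<xi> \<bullet> v) * (\<xi> \<bullet> \<xi>))
      + \<epsilon> * (- (4 * \<epsilon> * r\<^sup>2 * (\<xi> \<bullet> v)) * (2 * r - 1)) = 0" .
  moreover have "amb \<epsilon> (tang \<xi> v) (dir \<xi>) =
      2 * r * (2 * r * (\<xi> \<bullet> v) - 4 * \<epsilon> * r\<^sup>2 * (\<xi> \<bullet> v) * (\<xi> \<bullet> \<xi>))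
      + \<epsilon> * (- (4 * \<epsilon> * r\<^sup>2 * (\<xi> \<bullet> v)) * (2 * r - 1))"
    by (simp add: amb_def r(1,2) inner_diff_left inner_commute[of v \<xi>])
  ultimately show ?thesis by simp
qed

text \<open>Since \<open>tang\<close> is the derivative of \<open>dir\<close>, this says that
  \<open>dir\<close> maps N with its metric \<open>e2u\<close> isometrically into the ambient
  space.\<close>

lemma amb_tang_tang:
  assumes "conf \<xi> \<noteq> 0"
  shows "amb \<epsilon> (tang \<xi> v) (tang \<xi> w) = 4 / (conf \<xi>)\<^sup>2 * (v \<bullet> w)"
proof -
  obtain r where r:
    "\<And>v. tang \<xi> v = (2 * r) *\<^sub>R (v, 0) - (4 * \<epsilon> * r\<^sup>2 * (\<xi> \<bullet> v)) *\<^sub>R (\<xi>, 1)"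
    "r + \<epsilon> * (\<xi> \<bullet> \<xi>) * r = 1" "r = 1 / conf \<xi>"
    using frame_eqs[OF assms] by metis
  have "2 * r * (2 * r * vw - 4 * \<epsilon> * r\<^sup>2 * q * p)
      - 4 * \<epsilon> * r\<^sup>2 * p * (2 * r * q - 4 * \<epsilon> * r\<^sup>2 * q * X)
      + \<epsilon> * (4 * \<epsilon> * r\<^sup>2 * p * (4 * \<epsilon> * r\<^sup>2 * q)) = 4 * r\<^sup>2 * vw"
    if "r + \<epsilon> * X * r = 1" for X p q vw
    using that sign_sq by algebra
  from this[OF r(2), of "v \<bullet> w" "\<xi> \<bullet> w" "\<xi> \<bullet> v"]
  have "amb \<epsilon> (tang \<xi> v) (tang \<xi> w) = 4 * r\<^sup>2 * (v \<bullet> w)"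
    by (simp add: amb_def r(1) inner_diff_left inner_diff_right inner_commute algebra_simps)
  then show ?thesis using r(3) by (simp add: power_divide)
qed

lemma linear_tang: "bounded_linear (tang \<xi>)"
  unfolding tang_def
  by (rule bounded_linear_sub[OF
        bounded_linear_compose[OF bounded_linear_scaleR_right
          bounded_linear_Pair[OF bounded_linear_ident bounded_linear_zero]]
        bounded_linear_compose[OF bounded_linear_scaleR_left
          bounded_linear_compose[OF bounded_linear_mult_right bounded_linear_inner_right]]])

lemmas tang_simps = linear_add[OF bounded_linear.linear[OF linear_tang]]
  linear_cmul[OF bounded_linear.linear[OF linear_tang]]
  linear_diff[OF bounded_linear.linear[OF linear_tang]]
  linear_neg[OF bounded_linear.linear[OF linear_tang]]
  linear_0[OF bounded_linear.linear[OF linear_tang]]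

text \<open>The frame defines an endomorphism of a 3-dimensional space, so injectivity suffices.
  Pairing an element of the kernel with \<open>dir\<close>, which is not null, and then with its own
  tangential part, where the form is definite, gives 0.\<close>

lemma frame_cases:
  assumes "conf \<xi> \<noteq> 0"
  obtains a c where "p = tang \<xi> a + c *\<^sub>R dir \<xi>"
proof -
  let ?f = "\<lambda>q. tang \<xi> (fst q) + snd q *\<^sub>R dir \<xi>"
  have lin: "linear ?f"
    by (rule linearI) (auto simp: tang_simps scaleR_add_left scaleR_add_right)
  have "inj ?f"
  proof (rule linear_injective_0[OF lin, THEN iffD2], intro allI impI)
    fix q assume q: "?f q = 0"
    have "amb \<epsilon> (?f q) (dir \<xi>) = snd q * \<epsilon>"
      by (simp add: amb_simps amb_tang_dir amb_dir_dir assms)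
    then have s: "snd q = 0" using q sign by (auto simp: amb_simps)
    have "amb \<epsilon> (?f q) (tang \<xi> (fst q)) = 4 / (conf \<xi>)\<^sup>2 * (fst q \<bullet> fst q)"
      by (simp add: amb_simps amb_tang_tang assms s)
    then have "fst q = 0" using q assms by (auto simp: amb_simps)
    with s show "q = 0" by (simp add: prod_eq_iff)
  qed
  then have "surj ?f" using linear_injective_imp_surjective[OF lin] by blast
  then obtain q where "p = ?f q" unfolding surj_def by blast
  then show ?thesis using that by blast
qed

lemma normal_vector_cases:
  assumes "conf \<xi> \<noteq> 0" "amb \<epsilon> n n = \<epsilon>" "\<And>a. amb \<epsilon> n (tang \<xi> a) = 0"
  shows "n = dir \<xi> \<or> n = - dir \<xi>"
proof -
  obtain a c where n: "n = tang \<xi> a + c *\<^sub>R dir \<xi>" using frame_cases[OF assms(1)] .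
  have "amb \<epsilon> n (tang \<xi> a) = 4 / (conf \<xi>)\<^sup>2 * (a \<bullet> a)"
    unfolding n using amb_tang_dir[OF assms(1)] 
    by (simp add: amb_simps amb_tang_tang assms(1) amb_commute[of "dir \<xi>"])
  then have a: "a = 0" using assms by auto
  then have nc: "n = c *\<^sub>R dir \<xi>" using n by (simp add: tang_simps)
  then have "c * c * \<epsilon> = \<epsilon>" using assms by (simp add: amb_simps amb_dir_dir)
  then have "c * c = 1" using sign by auto
  then have "c = 1 \<or> c = -1" by (simp add: square_eq_1_iff)
  then show ?thesis using nc by auto
qed

section \<open>Derivatives of the frame\<close>

lemma has_derivative_conf: "(conf has_derivative (\<lambda>v. 2 * \<epsilon> * (\<xi> \<bullet> v))) (at \<xi>)"
  unfolding conf_def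
  by (auto intro!: derivative_eq_intros simp: inner_commute fun_eq_iff)

lemma has_derivative_dir:
  assumes "conf \<xi> \<noteq> 0"
  shows "(dir has_derivative tang \<xi>) (at \<xi>)"
  unfolding dir_def
  apply (rule derivative_eq_intros has_derivative_conf has_derivative_Pair assms refl)+
  apply (auto simp: fun_eq_iff tang_def power2_eq_square divide_inverse algebra_simps)
  done

text \<open>The Gauss formula of the unit sphere or hyperboloid: the tangential part is the
  Christoffel term of \<open>e2u\<close>, with symbol - 2 \<epsilon> cnj \<xi> / w, and the part
  along \<open>dir\<close> is the second fundamental form.\<close>

lemma has_derivative_tang:
  assumes "conf \<xi> \<noteq> 0"
  shows "((\<lambda>\<xi>. tang \<xi> \<eta>) has_derivative (\<lambda>v.
    tang \<xi> (- (2 * of_real \<epsilon> * cnj \<xi> * \<eta> * v / of_real (conf \<xi>)))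
    - (4 * \<epsilon> / (conf \<xi>)\<^sup>2 * (\<eta> \<bullet> v)) *\<^sub>R dir \<xi>)) (at \<xi>)"
proof -
  obtain r where r: "dir \<xi> = (2 * r) *\<^sub>R (\<xi>, 1) - (0, 1)"
    "\<And>v. tang \<xi> v = (2 * r) *\<^sub>R (v, 0) - (4 * \<epsilon> * r\<^sup>2 * (\<xi> \<bullet> v)) *\<^sub>R (\<xi>, 1)"
    "r * conf \<xi> = 1" "r + \<epsilon> * (\<xi> \<bullet> \<xi>) * r = 1" "r = 1 / conf \<xi>"
    using frame_eqs[OF assms] by metis
  obtain x y where x: "\<xi> = Complex x y" by (cases \<xi>)
  obtain a b where a: "\<eta> = Complex a b" by (cases \<eta>)
  have ee: "\<epsilon> * \<epsilon> = 1" by (rule sign_sq)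
  have rx: "r + \<epsilon> * (x * x + y * y) * r = 1"
    using r(4) by (simp add: x inner_complex_def)
  \<comment> \<open>The bare outcome of the product rule; its frame components are identified at the
    end by an identity in real coordinates.\<close>
  let ?D = "\<lambda>v. (- (4 * \<epsilon> * r\<^sup>2 * (\<xi> \<bullet> v))) *\<^sub>R (\<eta>, 0)
      - ((4 * \<epsilon> * r\<^sup>2 * (v \<bullet> \<eta>) - 16 * r ^ 3 * (\<xi> \<bullet> v) * (\<xi> \<bullet> \<eta>)) *\<^sub>R (\<xi>, 1)
        + (4 * \<epsilon> * r\<^sup>2 * (\<xi> \<bullet> \<eta>)) *\<^sub>R (v, 0))"
  define R where "R = (\<lambda>\<xi>. 1 / conf \<xi>)"
  have rR: "R \<xi> = r" by (simp add: R_def r(5))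
  have dr: "(R has_derivative (\<lambda>v. - 2 * \<epsilon> * (\<xi> \<bullet> v) * r\<^sup>2)) (at \<xi>)"
    unfolding R_def
    apply (rule has_derivative_eq_rhs)
     apply (rule derivative_eq_intros has_derivative_conf assms refl)+
    apply (simp add: r(5) fun_eq_iff power2_eq_square divide_inverse)
    done
  have "((\<lambda>\<xi>. (2 * R \<xi>) *\<^sub>R (\<eta>, 0) - (4 * \<epsilon> * (R \<xi>)\<^sup>2 * (\<xi> \<bullet> \<eta>)) *\<^sub>R (\<xi>, 1::real))
     has_derivative ?D) (at \<xi>)"
    apply (rule has_derivative_eq_rhs)
     apply (rule derivative_eq_intros dr has_derivative_Pair assms refl)+
    apply (rule ext)
    unfolding rR
    using ee
    apply (simp add: prod_eq_iff power2_eq_square power3_eq_cube algebra_simps)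
    done
  moreover have "(\<lambda>\<xi>. tang \<xi> \<eta>) =
     (\<lambda>\<xi>. (2 * R \<xi>) *\<^sub>R (\<eta>, 0) - (4 * \<epsilon> * (R \<xi>)\<^sup>2 * (\<xi> \<bullet> \<eta>)) *\<^sub>R (\<xi>, 1))"
    by (simp add: tang_def fun_eq_iff power_divide R_def)
  moreover have "?D v = tang \<xi> (- (2 * of_real \<epsilon> * cnj \<xi> * \<eta> * v / of_real (conf \<xi>)))
    - (4 * \<epsilon> / (conf \<xi>)\<^sup>2 * (\<eta> \<bullet> v)) *\<^sub>R dir \<xi>" for v
  proof -
    obtain p q where v: "v = Complex p q" by (cases v)
    have 1: "4 * \<epsilon> / (conf \<xi>)\<^sup>2 = 4 * \<epsilon> * r\<^sup>2"
      by (simp add: r(5) power_divide)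
    have 2: "- (2 * of_real \<epsilon> * cnj \<xi> * \<eta> * v / of_real (conf \<xi>))
       = Complex (- 2 * \<epsilon> * r * ((x * a + y * b) * p - (x * b - y * a) * q))
           (- 2 * \<epsilon> * r * ((x * a + y * b) * q + (x * b - y * a) * p))"
      by (simp add: r(5) x a v complex_eq_iff; intro conjI disjI2) algebra+
    show ?thesis
      unfolding 1 2 r(2) r(1)
      unfolding x a v
      by (simp add: prod_eq_iff complex_eq_iff inner_complex_def; intro conjI disjI2)
         (use ee rx in algebra)+
  qed
  ultimately show ?thesis by simp
qed

text \<open>\<open>dir\<close> is the inverse of stereographic projection from (0, -1).\<close>

lemma dir_inverse:
  assumes "conf \<xi> \<noteq> 0"
  shows "\<xi> = fst (dir \<xi>) /\<^sub>R (1 + snd (dir \<xi>))"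
  using assms by (simp add: dir_def)

text \<open>The incidence relation: given the direction, \<eta> is a polynomial in any point of the
  line, with the parameter s eliminated. It makes the section smooth once the surface is smooth and
  parametrised by \<xi>.\<close>

lemma line_point_inverse:
  assumes "conf \<xi> \<noteq> 0" "p = line_point \<epsilon> (\<xi>, \<eta>) s"
  shows "\<eta> = (fst p - 2 * of_real (snd p) * \<xi> - of_real \<epsilon> * cnj (fst p) * \<xi>\<^sup>2) / 2"
proof -
  obtain r where r: "dir \<xi> = (2 * r) *\<^sub>R (\<xi>, 1) - (0, 1)"
    "\<And>v. tang \<xi> v = (2 * r) *\<^sub>R (v, 0) - (4 * \<epsilon> * r\<^sup>2 * (\<xi> \<bullet> v)) *\<^sub>R (\<xi>, 1)"
    "r + \<epsilon> * (\<xi> \<bullet> \<xi>) * r = 1"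
    using frame_eqs[OF assms(1)] by metis
  obtain x y where x: "\<xi> = Complex x y" by (cases \<xi>)
  obtain a b where a: "\<eta> = Complex a b" by (cases \<eta>)
  have ee: "\<epsilon> * \<epsilon> = 1" by (rule sign_sq)
  have rx: "r + \<epsilon> * (x * x + y * y) * r = 1"
    using r(3) by (simp add: x inner_complex_def)
  have p: "p = tang \<xi> \<eta> + s *\<^sub>R dir \<xi>" using line_point_eq assms by simp
  show ?thesis
    unfolding p r(1,2) unfolding x a
    by (simp add: complex_eq_iff inner_complex_def power2_eq_square; intro conjI)
       (use ee rx in algebra)+
qed

text \<open>The vector product of the ambient space: \<open>amb \<epsilon> (normal_cross p q) r\<close> is the determinant of
  \<open>p\<close>, \<open>q\<close>, \<open>r\<close>.\<close>

definition normal_cross :: "complex \<times> real \<Rightarrow> complex \<times> real \<Rightarrow> complex \<times> real" where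
  "normal_cross p q = (\<i> * (of_real (snd p) * fst q - of_real (snd q) * fst p),
     \<epsilon> * Im (cnj (fst p) * fst q))"

text \<open>\<open>Im (cnj a * b)\<close> is the oriented area of a and b, so independent tangent
  vectors have a nonzero multiple of the direction as their product.\<close>

lemma normal_cross_tang:
  assumes "conf \<xi> \<noteq> 0"
  shows "normal_cross (tang \<xi> a) (tang \<xi> b) = (4 * \<epsilon> / (conf \<xi>)\<^sup>2 * Im (cnj a * b)) *\<^sub>R dir \<xi>"
proof -
  obtain r where r: "dir \<xi> = (2 * r) *\<^sub>R (\<xi>, 1) - (0, 1)"
    "\<And>v. tang \<xi> v = (2 * r) *\<^sub>R (v, 0) - (4 * \<epsilon> * r\<^sup>2 * (\<xi> \<bullet> v)) *\<^sub>R (\<xi>, 1)"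
    "r + \<epsilon> * (\<xi> \<bullet> \<xi>) * r = 1" "r = 1 / conf \<xi>"
    using frame_eqs[OF assms] by metis
  obtain x y where x: "\<xi> = Complex x y" by (cases \<xi>)
  obtain a1 a2 where a: "a = Complex a1 a2" by (cases a)
  obtain b1 b2 where b: "b = Complex b1 b2" by (cases b)
  have ee: "\<epsilon> * \<epsilon> = 1" by (rule sign_sq)
  have rx: "r + \<epsilon> * (x * x + y * y) * r = 1"
    using r(3) by (simp add: x inner_complex_def)
  have 1: "4 * \<epsilon> / (conf \<xi>)\<^sup>2 = 4 * \<epsilon> * r\<^sup>2"
    by (simp add: r(4) power_divide)
  show ?thesis
    unfolding normal_cross_def 1 r(1,2) unfolding x a b
    by (simp add: prod_eq_iff complex_eq_iff inner_complex_def; intro conjI disjI2)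
       (use ee rx in algebra)+
qed

end

section \<open>The differential equation\<close>

lemma wirt_eqI: "(f has_derivative f') (at \<xi>) \<Longrightarrow> wirt f \<xi> = (f' 1 - \<i> * f' \<i>) / 2"
  by (simp add: wirt_def frechet_derivative_eqI)

lemma wirt_bar_eqI: "(f has_derivative f') (at \<xi>) \<Longrightarrow> wirt_bar f \<xi> = (f' 1 + \<i> * f' \<i>) / 2"
  by (simp add: wirt_bar_def frechet_derivative_eqI)

lemma derivative_eq_wirt:
  assumes "f differentiable at \<xi>"
  shows "frechet_derivative f (at \<xi>) v = wirt f \<xi> * v + wirt_bar f \<xi> * cnj v"
proof -
  let ?d = "frechet_derivative f (at \<xi>)"
  have l: "linear ?d" using linear_frechet_derivative[OF assms] .
  have "v = Re v *\<^sub>R 1 + Im v *\<^sub>R \<i>" by (simp add: complex_eq_iff)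
  then have "?d v = Re v *\<^sub>R ?d 1 + Im v *\<^sub>R ?d \<i>"
    by (metis linear_add[OF l] linear_cmul[OF l])
  then show ?thesis
    by (simp add: wirt_def wirt_bar_def complex_eq_iff field_simps)
qed

lemma wirt_cnj:
  assumes "f differentiable at \<xi>"
  shows "wirt (\<lambda>w. cnj (f w)) \<xi> = cnj (wirt_bar f \<xi>)"
proof -
  have "((\<lambda>w. cnj (f w)) has_derivative (\<lambda>v. cnj (frechet_derivative f (at \<xi>) v))) (at \<xi>)"
    using has_derivative_cnj assms frechet_derivative_works by blast
  from wirt_eqI[OF this] show ?thesis
    by (simp add: wirt_bar_def)
qed

lemma wirt_bar_cnj:
  assumes "f differentiable at \<xi>"
  shows "wirt_bar (\<lambda>w. cnj (f w)) \<xi> = cnj (wirt f \<xi>)"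
proof -
  have "((\<lambda>w. cnj (f w)) has_derivative (\<lambda>v. cnj (frechet_derivative f (at \<xi>) v))) (at \<xi>)"
    using has_derivative_cnj assms frechet_derivative_works by blast
  from wirt_bar_eqI[OF this] show ?thesis
    by (simp add: wirt_def)
qed

lemma wirt_bar_mult:
  assumes "f differentiable at \<xi>" "g differentiable at \<xi>"
  shows "wirt_bar (\<lambda>w. f w * g w) \<xi> = wirt_bar f \<xi> * g \<xi> + f \<xi> * wirt_bar g \<xi>"
proof -
  have "((\<lambda>w. f w * g w) has_derivative
      (\<lambda>v. f \<xi> * frechet_derivative g (at \<xi>) v + frechet_derivative f (at \<xi>) v * g \<xi>)) (at \<xi>)"
    using has_derivative_mult assms frechet_derivative_works by blast
  from wirt_bar_eqI[OF this] show ?thesis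
    by (simp add: wirt_bar_def algebra_simps add_divide_distrib)
qed

lemma wirt_bar_diff:
  assumes "f differentiable at \<xi>" "g differentiable at \<xi>"
  shows "wirt_bar (\<lambda>w. f w - g w) \<xi> = wirt_bar f \<xi> - wirt_bar g \<xi>"
proof -
  have "((\<lambda>w. f w - g w) has_derivative
      (\<lambda>v. frechet_derivative f (at \<xi>) v - frechet_derivative g (at \<xi>) v)) (at \<xi>)"
    using has_derivative_diff assms frechet_derivative_works by blast
  from wirt_bar_eqI[OF this] show ?thesis
    by (simp add: wirt_bar_def algebra_simps diff_divide_distrib)
qed

lemma wirt_bar_cong:
  assumes "open S" "\<xi> \<in> S" "\<And>w. w \<in> S \<Longrightarrow> f w = g w"
  shows "wirt_bar f \<xi> = wirt_bar g \<xi>"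
  unfolding wirt_bar_def using frechet_derivative_cong[OF assms] by simp

lemma wirt_cong:
  assumes "open S" "\<xi> \<in> S" "\<And>w. w \<in> S \<Longrightarrow> f w = g w"
  shows "wirt f \<xi> = wirt g \<xi>"
  unfolding wirt_def using frechet_derivative_cong[OF assms] by simp

lemma smooth_on_imp_differentiable: "smooth_on S f \<Longrightarrow> x \<in> S \<Longrightarrow> f differentiable at x"
  using smooth_on_has_derivative differentiable_def by blast

text \<open>Expanded in second partial derivatives, the two sides differ only in the order of the
  mixed ones.\<close>

lemma wirt_wirt_bar_commute:
  assumes "open S" "smooth_on S f" "\<xi> \<in> S"
  shows "wirt (wirt_bar f) \<xi> = wirt_bar (wirt f) \<xi>"
proof -
  let ?d = "\<lambda>v y. frechet_derivative f (at y) v"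
  have d: "(?d v has_derivative frechet_derivative (?d v) (at \<xi>)) (at \<xi>)" for v
    by (rule smooth_on_has_derivative[OF smooth_on_frechet_derivative[OF assms(2)] assms(3)])
  have *: "((\<lambda>y. (?d 1 y - \<i> * ?d \<i> y) / 2) has_derivative
      (\<lambda>v. (frechet_derivative (?d 1) (at \<xi>) v - \<i> * frechet_derivative (?d \<i>) (at \<xi>) v) / 2)) (at \<xi>)"
    "((\<lambda>y. (?d 1 y + \<i> * ?d \<i> y) / 2) has_derivative
      (\<lambda>v. (frechet_derivative (?d 1) (at \<xi>) v + \<i> * frechet_derivative (?d \<i>) (at \<xi>) v) / 2)) (at \<xi>)"
    by (intro bounded_linear.has_derivative[OF bounded_linear_divide] has_derivative_diff has_derivative_add d
        has_derivative_mult_right)+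
  have "frechet_derivative (?d 1) (at \<xi>) \<i> = frechet_derivative (?d \<i>) (at \<xi>) 1"
    by (rule symmetric_second_derivative[OF assms(1,3)]) (use assms(2) smooth_on_def in blast)
  moreover have "wirt f = (\<lambda>y. (?d 1 y - \<i> * ?d \<i> y) / 2)"
      "wirt_bar f = (\<lambda>y. (?d 1 y + \<i> * ?d \<i> y) / 2)"
    by (simp_all add: fun_eq_iff wirt_def wirt_bar_def)
  ultimately show ?thesis
    by (simp only: wirt_bar_eqI[OF *(1)] wirt_eqI[OF *(2)]) (simp add: field_simps)
qed

context sign
begin

lemma conf_ne: "\<xi> \<in> N \<epsilon> \<Longrightarrow> conf \<xi> \<noteq> 0"
  using conf_pos by force

lemma has_derivative_inverse_conf:
  assumes "conf \<xi> \<noteq> 0"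
  shows "((\<lambda>\<xi>. 1 / complex_of_real (conf \<xi>)) has_derivative
    (\<lambda>v. - of_real (2 * \<epsilon> * (\<xi> \<bullet> v)) / of_real (conf \<xi>) ^ 2)) (at \<xi>)"
  apply (rule has_derivative_eq_rhs)
   apply (rule derivative_eq_intros has_derivative_conf refl | simp add: assms)+
  apply (simp add: fun_eq_iff power2_eq_square divide_inverse)
  done

lemma wirt_bar_inverse_conf:
  assumes "conf \<xi> \<noteq> 0"
  shows "wirt_bar (\<lambda>\<xi>. 1 / complex_of_real (conf \<xi>)) \<xi> = - (of_real \<epsilon> * \<xi> / of_real (conf \<xi>) ^ 2)"
  unfolding wirt_bar_eqI[OF has_derivative_inverse_conf[OF assms]]
  using assms by (simp add: inner_complex_def field_simps complex_eq_iff)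

definition minimal_equation :: "(complex \<Rightarrow> complex) \<Rightarrow> complex \<Rightarrow> bool" where
  "minimal_equation F \<xi> \<longleftrightarrow>
     wirt_bar (\<lambda>\<zeta>. wirt (\<lambda>w. cnj (F w)) \<zeta> / (1 + of_real \<epsilon> * \<zeta> * cnj \<zeta>) ^ 2) \<xi> = 0"

text \<open>The product rule with \<partial>(1/w)/\<partial>(cnj \<xi>) = - \<epsilon> \<xi> / w^2,
  followed by conjugation. Commuting the Wirtinger derivatives brings in a derivative of
  \<partial>F, the quantity that the height of a minimal surface determines.\<close>

lemma minimal_equation_iff:
  assumes V: "open V" "V \<subseteq> N \<epsilon>" and F: "smooth_on V F" and \<xi>: "\<xi> \<in> V"
  shows "minimal_equation F \<xi> \<longleftrightarrow>
    wirt_bar (wirt F) \<xi> = 2 * of_real \<epsilon> * cnj \<xi> * wirt_bar F \<xi> / of_real (conf \<xi>)"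
proof -
  let ?K = "\<lambda>\<xi>. 1 / complex_of_real (conf \<xi>)"
  define k where "k = ?K \<xi>"
  have c: "conf \<xi> \<noteq> 0" using conf_ne V(2) \<xi> by blast
  then have k0: "k \<noteq> 0" by (simp add: k_def)
  have dK: "?K differentiable at \<xi>"
    using has_derivative_inverse_conf[OF c] differentiable_def by blast
  define P where "P = (\<lambda>\<zeta>. cnj (wirt_bar F \<zeta>))"
  have F1: "F differentiable at \<zeta>" if "\<zeta> \<in> V" for \<zeta>
    using smooth_on_imp_differentiable[OF F that] .
  have "smooth_on V (\<lambda>\<zeta>. wirt (\<lambda>w. cnj (F w)) \<zeta>)"
    by (intro smooth_intros V F)
  then have "smooth_on V P"
    by (rule smooth_on_cong[OF V(1)]) (simp add: wirt_cnj F1 P_def)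
  then have dP: "P differentiable at \<xi>"
    using smooth_on_imp_differentiable \<xi> by blast
  have "smooth_on V (\<lambda>\<zeta>. cnj (P \<zeta>))"
    by (intro smooth_intros V \<open>smooth_on V P\<close>)
  then have dB: "wirt_bar F differentiable at \<xi>"
    using smooth_on_imp_differentiable \<xi> by (fastforce simp: P_def)
  have "wirt_bar (\<lambda>\<zeta>. wirt (\<lambda>w. cnj (F w)) \<zeta> / (1 + of_real \<epsilon> * \<zeta> * cnj \<zeta>) ^ 2) \<xi>
      = wirt_bar (\<lambda>\<zeta>. P \<zeta> * (?K \<zeta> * ?K \<zeta>)) \<xi>"
    by (rule wirt_bar_cong[OF V(1) \<xi>])
       (simp add: P_def wirt_cnj F1 power2_eq_square flip: conf_complex)
  also have "\<dots> = wirt_bar P \<xi> * (k * k) + P \<xi> * (wirt_bar ?K \<xi> * k + k * wirt_bar ?K \<xi>)"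
    using wirt_bar_mult[OF dP differentiable_mult[OF dK dK]] wirt_bar_mult[OF dK dK]
    by (simp add: k_def)
  also have "wirt_bar ?K \<xi> = - (of_real \<epsilon> * \<xi> * (k * k))"
    using wirt_bar_inverse_conf[OF c] by (simp add: k_def power2_eq_square)
  also have "wirt_bar P \<xi> = cnj (wirt_bar (wirt F) \<xi>)"
    unfolding P_def using wirt_bar_cnj[OF dB] wirt_wirt_bar_commute[OF V(1) F \<xi>] by simp
  also have "cnj (wirt_bar (wirt F) \<xi>) * (k * k)
      + P \<xi> * (- (of_real \<epsilon> * \<xi> * (k * k)) * k + k * - (of_real \<epsilon> * \<xi> * (k * k)))
      = (k * k) * (cnj (wirt_bar (wirt F) \<xi>) - 2 * of_real \<epsilon> * \<xi> * P \<xi> * k)"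
    by (simp add: algebra_simps)
  finally have "minimal_equation F \<xi> \<longleftrightarrow>
      (k * k) * (cnj (wirt_bar (wirt F) \<xi>) - 2 * of_real \<epsilon> * \<xi> * P \<xi> * k) = 0"
    unfolding minimal_equation_def by simp
  also have "\<dots> \<longleftrightarrow> cnj (wirt_bar (wirt F) \<xi>) = 2 * of_real \<epsilon> * \<xi> * P \<xi> * k"
    using k0 by simp
  also have "\<dots> \<longleftrightarrow> wirt_bar (wirt F) \<xi> = cnj (2 * of_real \<epsilon> * \<xi> * P \<xi> * k)"
    by (metis complex_cnj_cnj)
  also have "cnj (2 * of_real \<epsilon> * \<xi> * P \<xi> * k)
      = 2 * of_real \<epsilon> * cnj \<xi> * wirt_bar F \<xi> / of_real (conf \<xi>)"
    by (simp add: P_def k_def)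
  finally show ?thesis .
qed

text \<open>Orthogonality of the line through \<open>\<xi>\<close> to the surface at height \<open>\<rho>\<close> prescribes the gradient
  of \<open>\<rho>\<close>. If \<open>\<rho>\<close> is the height that makes the mean curvature vanish, this is the
  differential equation for the section.\<close>

lemma minimal_equation_gradient:
  assumes V: "open V" "V \<subseteq> N \<epsilon>" and F: "smooth_on V F" and \<xi>: "\<xi> \<in> V"
    and \<rho>: "\<And>\<zeta>. \<zeta> \<in> V \<Longrightarrow>
      wirt F \<zeta> = 2 * of_real \<epsilon> * cnj \<zeta> * F \<zeta> / of_real (conf \<zeta>) - of_real (\<rho> \<zeta>)"
    and d\<rho>: "(\<rho> has_derivative \<rho>') (at \<xi>)"
  shows "minimal_equation F \<xi> \<longleftrightarrow> (\<forall>a. \<rho>' a = 4 * \<epsilon> / (conf \<xi>)\<^sup>2 * (F \<xi> \<bullet> a))"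
proof -
  let ?K = "\<lambda>\<xi>. 1 / complex_of_real (conf \<xi>)"
  define k where "k = ?K \<xi>"
  have c: "conf \<xi> \<noteq> 0" using conf_ne V(2) \<xi> by blast
  have dK: "?K differentiable at \<xi>"
    using has_derivative_inverse_conf[OF c] differentiable_def by blast
  have dF: "F differentiable at \<xi>"
    using smooth_on_imp_differentiable[OF F \<xi>] .
  have dc: "cnj differentiable at \<xi>"
    using has_derivative_cnj[OF has_derivative_ident] differentiable_def by blast
  have dr: "((\<lambda>x. complex_of_real (\<rho> x)) has_derivative (\<lambda>v. of_real (\<rho>' v))) (at \<xi>)"
    using has_derivative_of_real[OF d\<rho>] .
  then have dr': "(\<lambda>x. complex_of_real (\<rho> x)) differentiable at \<xi>"
    using differentiable_def by blast
  have d1: "(\<lambda>\<zeta>. cnj \<zeta> * F \<zeta>) differentiable at \<xi>" "(\<lambda>\<zeta>. cnj \<zeta> * F \<zeta> * ?K \<zeta>) differentiable at \<xi>"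
    "(\<lambda>\<zeta>. 2 * complex_of_real \<epsilon>) differentiable at \<xi>"
    by (intro differentiable_mult dc dF dK differentiable_const)+
  have d2: "(\<lambda>\<zeta>. 2 * of_real \<epsilon> * (cnj \<zeta> * F \<zeta> * ?K \<zeta>)) differentiable at \<xi>"
    by (intro differentiable_mult d1)
  have wc: "wirt_bar cnj \<xi> = 1"
    using wirt_bar_eqI[OF has_derivative_cnj[OF has_derivative_ident]] by simp
  have w2: "wirt_bar (\<lambda>\<zeta>. 2 * complex_of_real \<epsilon>) \<xi> = 0"
    by (simp add: wirt_bar_def)
  have wK: "wirt_bar ?K \<xi> = - (of_real \<epsilon> * \<xi> * (k * k))"
    using wirt_bar_inverse_conf[OF c] by (simp add: k_def power2_eq_square)
  have "wirt_bar (wirt F) \<xi>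
      = wirt_bar (\<lambda>\<zeta>. 2 * of_real \<epsilon> * (cnj \<zeta> * F \<zeta> * ?K \<zeta>) - of_real (\<rho> \<zeta>)) \<xi>"
    by (rule wirt_bar_cong[OF V(1) \<xi>]) (simp add: \<rho>)
  also have "\<dots> = 2 * of_real \<epsilon> * ((F \<xi> + cnj \<xi> * wirt_bar F \<xi>) * k
       - cnj \<xi> * F \<xi> * (of_real \<epsilon> * \<xi> * (k * k))) - (of_real (\<rho>' 1) + \<i> * of_real (\<rho>' \<i>)) / 2"
    unfolding wirt_bar_diff[OF d2 dr'] wirt_bar_mult[OF d1(3,2)] wirt_bar_mult[OF d1(1) dK]
      wirt_bar_mult[OF dc dF] wc w2 wK wirt_bar_eqI[OF dr]
    by (simp add: k_def)
  \<comment> \<open>The terms containing F undifferentiated combine, because k w = 1 gives k -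
    \<epsilon> |\<xi>|^2 k^2 = k^2. The first summand is the right-hand side of
    \<open>minimal_equation_iff\<close>, so the equation says that the bracket vanishes.\<close>
  also have "\<dots> = 2 * of_real \<epsilon> * cnj \<xi> * wirt_bar F \<xi> * k
      + (2 * of_real \<epsilon> * (k * k) * F \<xi> - (of_real (\<rho>' 1) + \<i> * of_real (\<rho>' \<i>)) / 2)"
  proof -
    have "k * (1 + of_real \<epsilon> * \<xi> * cnj \<xi>) = 1"
      using c by (simp add: k_def flip: conf_complex)
    moreover have "complex_of_real \<epsilon> * of_real \<epsilon> = 1"
      using sign_sq by (metis of_real_1 of_real_mult)
    ultimately show ?thesis by algebra
  qed
  finally have "minimal_equation F \<xi> \<longleftrightarrow>
      2 * of_real \<epsilon> * (k * k) * F \<xi> - (of_real (\<rho>' 1) + \<i> * of_real (\<rho>' \<i>)) / 2 = 0"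
    unfolding minimal_equation_iff[OF V F \<xi>] by (simp add: k_def)
  \<comment> \<open>The left-hand side is the gradient of \<rho> written as a complex
    number.\<close>
  also have "\<dots> \<longleftrightarrow>
      of_real (\<rho>' 1) + \<i> * of_real (\<rho>' \<i>) = 4 * of_real \<epsilon> * (k * k) * F \<xi>"
    by (auto simp: field_simps)
  also have "\<dots> \<longleftrightarrow> of_real (\<rho>' 1) + \<i> * of_real (\<rho>' \<i>) = (4 * \<epsilon> / (conf \<xi>)\<^sup>2) *\<^sub>R F \<xi>"
    by (simp add: k_def scaleR_conv_of_real power2_eq_square)
  also have "\<dots> \<longleftrightarrow> \<rho>' 1 = 4 * \<epsilon> / (conf \<xi>)\<^sup>2 * Re (F \<xi>) \<and> \<rho>' \<i> = 4 * \<epsilon> / (conf \<xi>)\<^sup>2 * Im (F \<xi>)"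
    by (auto simp: complex_eq_iff)
  also have "\<dots> \<longleftrightarrow> (\<forall>a. \<rho>' a = 4 * \<epsilon> / (conf \<xi>)\<^sup>2 * (F \<xi> \<bullet> a))"
  proof
    assume *: "\<rho>' 1 = 4 * \<epsilon> / (conf \<xi>)\<^sup>2 * Re (F \<xi>) \<and> \<rho>' \<i> = 4 * \<epsilon> / (conf \<xi>)\<^sup>2 * Im (F \<xi>)"
    show "\<forall>a. \<rho>' a = 4 * \<epsilon> / (conf \<xi>)\<^sup>2 * (F \<xi> \<bullet> a)"
    proof
      fix a
      have l: "linear \<rho>'" using d\<rho> has_derivative_linear by blast
      have "a = Re a *\<^sub>R 1 + Im a *\<^sub>R \<i>" by (simp add: complex_eq_iff)
      then have "\<rho>' a = Re a * \<rho>' 1 + Im a * \<rho>' \<i>"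
        by (metis linear_add[OF l] linear_cmul[OF l] real_scaleR_def)
      with * show "\<rho>' a = 4 * \<epsilon> / (conf \<xi>)\<^sup>2 * (F \<xi> \<bullet> a)"
        by (simp add: inner_complex_def algebra_simps add_divide_distrib)
    qed
  qed (simp add: inner_complex_def)
  finally show ?thesis .
qed

section \<open>Surfaces with a prescribed Gauss map\<close>

text \<open>The tangential part is the covariant derivative of the vector field F on N plus \<rho>
  a, the latter because moving along the lines changes the base point by \<rho> times the derivative
  of \<open>dir\<close>.\<close>

lemma has_derivative_line_surface:
  assumes c: "conf \<xi> \<noteq> 0"
    and F: "(F has_derivative F') (at \<xi>)" and \<rho>: "(\<rho> has_derivative \<rho>') (at \<xi>)"
  shows "((\<lambda>\<zeta>. tang \<zeta> (F \<zeta>) + \<rho> \<zeta> *\<^sub>R dir \<zeta>) has_derivative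
    (\<lambda>a. tang \<xi> (F' a + (of_real (\<rho> \<xi>) - 2 * of_real \<epsilon> * cnj \<xi> * F \<xi> / of_real (conf \<xi>)) * a)
       + (\<rho>' a - 4 * \<epsilon> / (conf \<xi>)\<^sup>2 * (F \<xi> \<bullet> a)) *\<^sub>R dir \<xi>)) (at \<xi>)"
proof -
  \<comment> \<open>\<open>has_derivative_tang\<close> differentiates with \<eta> fixed; writing F
    in the real basis 1, \<i> reduces the variable argument to fixed ones with scalar
    coefficients.\<close>
  have split: "tang \<zeta> \<eta> = Re \<eta> *\<^sub>R tang \<zeta> 1 + Im \<eta> *\<^sub>R tang \<zeta> \<i>" for \<zeta> \<eta>
  proof -
    have "\<eta> = Re \<eta> *\<^sub>R 1 + Im \<eta> *\<^sub>R \<i>" by (simp add: complex_eq_iff)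
    then show ?thesis by (metis tang_simps(1,2))
  qed
  define T where "T = (\<lambda>\<eta> v. tang \<xi> (- (2 * of_real \<epsilon> * cnj \<xi> * \<eta> * v / of_real (conf \<xi>)))
    - (4 * \<epsilon> / (conf \<xi>)\<^sup>2 * (\<eta> \<bullet> v)) *\<^sub>R dir \<xi>)"
  have dT: "((\<lambda>\<zeta>. tang \<zeta> \<eta>) has_derivative T \<eta>) (at \<xi>)" for \<eta>
    unfolding T_def by (rule has_derivative_tang[OF c])
  have Tlin: "T \<eta> v = Re \<eta> *\<^sub>R T 1 v + Im \<eta> *\<^sub>R T \<i> v" for \<eta> v
  proof -
    have "((\<lambda>\<zeta>. Re \<eta> *\<^sub>R tang \<zeta> 1 + Im \<eta> *\<^sub>R tang \<zeta> \<i>) has_derivative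
        (\<lambda>v. Re \<eta> *\<^sub>R T 1 v + Im \<eta> *\<^sub>R T \<i> v)) (at \<xi>)"
      by (intro has_derivative_add has_derivative_scaleR_right dT)
    then have "((\<lambda>\<zeta>. tang \<zeta> \<eta>) has_derivative (\<lambda>v. Re \<eta> *\<^sub>R T 1 v + Im \<eta> *\<^sub>R T \<i> v)) (at \<xi>)"
      by (simp flip: split)
    with dT have "T \<eta> = (\<lambda>v. Re \<eta> *\<^sub>R T 1 v + Im \<eta> *\<^sub>R T \<i> v)"
      using has_derivative_unique by blast
    then show ?thesis by metis
  qed
  have "((\<lambda>\<zeta>. Re (F \<zeta>) *\<^sub>R tang \<zeta> 1 + Im (F \<zeta>) *\<^sub>R tang \<zeta> \<i> + \<rho> \<zeta> *\<^sub>R dir \<zeta>) has_derivative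
     (\<lambda>a. (Re (F \<xi>) *\<^sub>R T 1 a + Re (F' a) *\<^sub>R tang \<xi> 1) + (Im (F \<xi>) *\<^sub>R T \<i> a + Im (F' a) *\<^sub>R tang \<xi> \<i>)
        + (\<rho> \<xi> *\<^sub>R tang \<xi> a + \<rho>' a *\<^sub>R dir \<xi>))) (at \<xi>)"
    by (intro has_derivative_add has_derivative_scaleR has_derivative_Re has_derivative_Im
        F \<rho> dT has_derivative_dir c)
  then have "((\<lambda>\<zeta>. tang \<zeta> (F \<zeta>) + \<rho> \<zeta> *\<^sub>R dir \<zeta>) has_derivative
     (\<lambda>a. (Re (F \<xi>) *\<^sub>R T 1 a + Re (F' a) *\<^sub>R tang \<xi> 1) + (Im (F \<xi>) *\<^sub>R T \<i> a + Im (F' a) *\<^sub>R tang \<xi> \<i>)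
        + (\<rho> \<xi> *\<^sub>R tang \<xi> a + \<rho>' a *\<^sub>R dir \<xi>))) (at \<xi>)"
    by (simp flip: split)
  then show ?thesis
  proof (rule has_derivative_eq_rhs, intro ext)
    fix a
    have "(Re (F \<xi>) *\<^sub>R T 1 a + Re (F' a) *\<^sub>R tang \<xi> 1) + (Im (F \<xi>) *\<^sub>R T \<i> a + Im (F' a) *\<^sub>R tang \<xi> \<i>)
        + (\<rho> \<xi> *\<^sub>R tang \<xi> a + \<rho>' a *\<^sub>R dir \<xi>)
      = T (F \<xi>) a + tang \<xi> (F' a) + \<rho> \<xi> *\<^sub>R tang \<xi> a + \<rho>' a *\<^sub>R dir \<xi>"
      unfolding Tlin[of "F \<xi>"] split[of \<xi> "F' a"] by simp
    also have "\<dots> = tang \<xi> (- (2 * of_real \<epsilon> * cnj \<xi> * F \<xi> * a / of_real (conf \<xi>)) + F' a + \<rho> \<xi> *\<^sub>R a)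
        + (\<rho>' a - 4 * \<epsilon> / (conf \<xi>)\<^sup>2 * (F \<xi> \<bullet> a)) *\<^sub>R dir \<xi>"
      by (simp add: T_def tang_simps scaleR_diff_left)
    also have "- (2 * of_real \<epsilon> * cnj \<xi> * F \<xi> * a / of_real (conf \<xi>)) + F' a + \<rho> \<xi> *\<^sub>R a
        = F' a + (of_real (\<rho> \<xi>) - 2 * of_real \<epsilon> * cnj \<xi> * F \<xi> / of_real (conf \<xi>)) * a"
      by (simp add: scaleR_conv_of_real algebra_simps)
    finally show "(Re (F \<xi>) *\<^sub>R T 1 a + Re (F' a) *\<^sub>R tang \<xi> 1) + (Im (F \<xi>) *\<^sub>R T \<i> a + Im (F' a) *\<^sub>R tang \<xi> \<i>)
        + (\<rho> \<xi> *\<^sub>R tang \<xi> a + \<rho>' a *\<^sub>R dir \<xi>)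
      = tang \<xi> (F' a + (of_real (\<rho> \<xi>) - 2 * of_real \<epsilon> * cnj \<xi> * F \<xi> / of_real (conf \<xi>)) * a)
       + (\<rho>' a - 4 * \<epsilon> / (conf \<xi>)\<^sup>2 * (F \<xi> \<bullet> a)) *\<^sub>R dir \<xi>" .
  qed
qed

end

context sign
begin

section \<open>The second fundamental form and the Gauss map\<close>

lemma second_form_symmetric:
  assumes "open U" "smooth_on U Y" "u \<in> U"
  shows "second_form \<epsilon> Y u n a b = second_form \<epsilon> Y u n b a"
proof -
  have "frechet_derivative (\<lambda>w. frechet_derivative Y (at w) b) (at u) a
      = frechet_derivative (\<lambda>w. frechet_derivative Y (at w) a) (at u) b"
    by (rule symmetric_second_derivative[OF assms(1,3)]) (use assms(2) smooth_on_def in blast)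
  then show ?thesis by (simp add: second_form_def)
qed

text \<open>The Weingarten equation: differentiate the orthogonality of the tangent vector along b
  and the normal.\<close>

lemma second_form_gauss:
  assumes U: "open U" "smooth_on U Y" "u \<in> U"
    and \<nu>: "(\<nu> has_derivative \<nu>') (at u)" "conf (\<nu> u) \<noteq> 0"
    and normal: "\<And>w a. w \<in> U \<Longrightarrow> amb \<epsilon> (frechet_derivative Y (at w) a) (dir (\<nu> w)) = 0"
  shows "second_form \<epsilon> Y u (dir (\<nu> u)) a b
    = - amb \<epsilon> (frechet_derivative Y (at u) b) (tang (\<nu> u) (\<nu>' a))"
proof -
  let ?d = "\<lambda>w. frechet_derivative Y (at w) b"
  have "(?d has_derivative frechet_derivative ?d (at u)) (at u)"
    by (rule smooth_on_has_derivative[OF smooth_on_frechet_derivative[OF U(2)] U(3)])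
  moreover have "((\<lambda>w. dir (\<nu> w)) has_derivative (\<lambda>a. tang (\<nu> u) (\<nu>' a))) (at u)"
    using has_derivative_compose[OF \<nu>(1) has_derivative_dir[OF \<nu>(2)]] .
  ultimately have "((\<lambda>w. amb \<epsilon> (?d w) (dir (\<nu> w))) has_derivative
     (\<lambda>a. amb \<epsilon> (?d u) (tang (\<nu> u) (\<nu>' a)) + amb \<epsilon> (frechet_derivative ?d (at u) a) (dir (\<nu> u)))) (at u)"
    by (rule bounded_bilinear.FDERIV[OF bounded_bilinear_amb])
  moreover have "((\<lambda>w. amb \<epsilon> (?d w) (dir (\<nu> w))) has_derivative (\<lambda>a. 0)) (at u)"
    by (rule has_derivative_transform_within_open[OF has_derivative_const U(1,3)])
       (simp add: normal)
  ultimately have "(\<lambda>a. amb \<epsilon> (?d u) (tang (\<nu> u) (\<nu>' a))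
      + amb \<epsilon> (frechet_derivative ?d (at u) a) (dir (\<nu> u))) = (\<lambda>a. 0)"
    by (rule has_derivative_unique)
  then have "amb \<epsilon> (?d u) (tang (\<nu> u) (\<nu>' a))
      + amb \<epsilon> (frechet_derivative ?d (at u) a) (dir (\<nu> u)) = 0"
    by metis
  then show ?thesis by (simp add: second_form_def)
qed

lemma amb_lincomb:
  "amb \<epsilon> (x *\<^sub>R p - y *\<^sub>R q) (x *\<^sub>R p - y *\<^sub>R q)
    = x * x * amb \<epsilon> p p - 2 * x * y * amb \<epsilon> p q + y * y * amb \<epsilon> q q"
  by (simp add: amb_simps amb_commute[of q p] algebra_simps)

text \<open>Positivity of the first form makes its Gram determinant, the denominator of the mean
  curvature, positive.\<close>

lemma mean_curvature_zero_iff: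
  fixes Y :: "complex \<Rightarrow> complex \<times> real"
  assumes d: "Y differentiable at u" and pos: "\<And>a. a \<noteq> 0 \<Longrightarrow> first_form \<epsilon> Y u a a > 0"
  shows "mean_curvature \<epsilon> Y u n = 0 \<longleftrightarrow>
    second_form \<epsilon> Y u n 1 1 * first_form \<epsilon> Y u \<i> \<i>
    - 2 * second_form \<epsilon> Y u n 1 \<i> * first_form \<epsilon> Y u 1 \<i>
    + second_form \<epsilon> Y u n \<i> \<i> * first_form \<epsilon> Y u 1 1 = 0"
proof -
  let ?D = "frechet_derivative Y (at u)"
  let ?g = "first_form \<epsilon> Y u"
  have l: "linear ?D" using linear_frechet_derivative[OF d] .
  \<comment> \<open>This vector is orthogonal to 1 with respect to the first form, and its square is
    \<open>?g 1 1\<close> times the Gram determinant.\<close>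
  define a where "a = (?g 1 \<i>) *\<^sub>R 1 - (?g 1 1) *\<^sub>R \<i>"
  have p1: "?g 1 1 > 0" using pos[of 1] by simp
  have "a \<noteq> 0" using p1 by (simp add: a_def complex_eq_iff)
  then have "?g a a > 0" using pos by blast
  also have "?D a = (?g 1 \<i>) *\<^sub>R ?D 1 - (?g 1 1) *\<^sub>R ?D \<i>"
    unfolding a_def by (simp only: linear_diff[OF l] linear_cmul[OF l])
  then have "?g a a = ?g 1 \<i> * ?g 1 \<i> * ?g 1 1 - 2 * ?g 1 \<i> * ?g 1 1 * ?g 1 \<i> + ?g 1 1 * ?g 1 1 * ?g \<i> \<i>"
    using amb_lincomb[of "?g 1 \<i>" "?D 1" "?g 1 1" "?D \<i>"] unfolding first_form_def by simp
  also have "\<dots> = ?g 1 1 * (?g 1 1 * ?g \<i> \<i> - (?g 1 \<i>)\<^sup>2)"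
    by (simp add: power2_eq_square algebra_simps)
  finally have "?g 1 1 * ?g \<i> \<i> - (?g 1 \<i>)\<^sup>2 > 0"
    using p1 by (simp add: zero_less_mult_iff)
  then show ?thesis
    by (simp add: mean_curvature_def Let_def)
qed

text \<open>A symmetric form that kills (x, y) is c times the square of the functional (u, v) |-> y
  u - x v. Its trace expression with g is then c times the value of g on (x, y), which forces c =
  0.\<close>

lemma trace_free_degenerate_form:
  fixes h11 :: real
  assumes "h11 * x + h12 * y = 0" "h12 * x + h22 * y = 0"
    and "g11 * x * x + 2 * g12 * x * y + g22 * y * y \<noteq> 0"
    and "h11 * g22 - 2 * h12 * g12 + h22 * g11 = 0"
  shows "h11 = 0 \<and> h12 = 0 \<and> h22 = 0"
proof -
  let ?Q = "g11 * x * x + 2 * g12 * x * y + g22 * y * y"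
  have "h11 * ?Q = 0" "h12 * ?Q = 0" "h22 * ?Q = 0"
    using assms(1,2,4) by algebra+
  with assms(3) show ?thesis by simp
qed

lemma complex_basis: "a = Re a *\<^sub>R 1 + Im a *\<^sub>R \<i>"
  by (simp add: complex_eq_iff)

lemma gauss_map_immersion:
  assumes U: "open U" "smooth_on U Y" "u \<in> U"
    and \<nu>: "(\<nu> has_derivative \<nu>') (at u)" "conf (\<nu> u) \<noteq> 0"
    and normal: "\<And>w a. w \<in> U \<Longrightarrow> amb \<epsilon> (frechet_derivative Y (at w) a) (dir (\<nu> w)) = 0"
    and pos: "\<And>a. a \<noteq> 0 \<Longrightarrow> first_form \<epsilon> Y u a a > 0"
    and minimal: "mean_curvature \<epsilon> Y u (dir (\<nu> u)) = 0"
    and nonflat: "second_form_eigenvalue \<epsilon> Y u (dir (\<nu> u)) k" "k \<noteq> 0"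
  shows "inj \<nu>'"
proof -
  let ?D = "frechet_derivative Y (at u)"
  let ?g = "first_form \<epsilon> Y u"
  let ?h = "second_form \<epsilon> Y u (dir (\<nu> u))"
  have d: "Y differentiable at u"
    using smooth_on_imp_differentiable[OF U(2,3)] .
  have lD: "linear ?D" using linear_frechet_derivative[OF d] .
  have l\<nu>: "linear \<nu>'" using \<nu>(1) has_derivative_linear by blast
  have D: "?D a = Re a *\<^sub>R ?D 1 + Im a *\<^sub>R ?D \<i>" for a
    by (metis complex_basis linear_add[OF lD] linear_cmul[OF lD])
  have N: "\<nu>' a = Re a *\<^sub>R \<nu>' 1 + Im a *\<^sub>R \<nu>' \<i>" for a
    by (metis complex_basis linear_add[OF l\<nu>] linear_cmul[OF l\<nu>])
  have h: "?h a b = - amb \<epsilon> (?D b) (tang (\<nu> u) (\<nu>' a))" for a b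
    by (rule second_form_gauss[OF U \<nu> normal])
  have sym: "?h \<i> 1 = ?h 1 \<i>"
    by (rule second_form_symmetric[OF U])
  have g: "?g a a = Re a * Re a * ?g 1 1 + 2 * Re a * Im a * ?g 1 \<i> + Im a * Im a * ?g \<i> \<i>" for a
    unfolding first_form_def D[of a]
    by (simp add: amb_simps amb_commute[of "?D \<i>" "?D 1"] algebra_simps)
  have hl: "?h a b = Re a * ?h 1 b + Im a * ?h \<i> b" for a b
    unfolding h N[of a] by (simp add: tang_simps amb_simps)
  have hr: "?h a b = Re b * ?h a 1 + Im b * ?h a \<i>" for a b
    unfolding h D[of b] by (simp add: amb_simps)
  show ?thesis
  proof (rule ccontr)
    assume "\<not> inj \<nu>'"
    then obtain a where a: "\<nu>' a = 0" "a \<noteq> 0"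
      using linear_injective_0[OF l\<nu>] by blast
    have "?h a b = 0" for b
      unfolding h a(1) by (simp add: tang_simps amb_simps)
    then have "?h 1 1 * Re a + ?h 1 \<i> * Im a = 0" "?h 1 \<i> * Re a + ?h \<i> \<i> * Im a = 0"
      using hl[of a 1] hl[of a \<i>] sym by (simp_all add: mult.commute)
    moreover have "?g 1 1 * Re a * Re a + 2 * ?g 1 \<i> * Re a * Im a + ?g \<i> \<i> * Im a * Im a \<noteq> 0"
      using pos[OF a(2)] g[of a] by (simp add: algebra_simps)
    moreover have "?h 1 1 * ?g \<i> \<i> - 2 * ?h 1 \<i> * ?g 1 \<i> + ?h \<i> \<i> * ?g 1 1 = 0"
      using mean_curvature_zero_iff[OF d pos] minimal by simp
    ultimately have "?h 1 1 = 0" "?h 1 \<i> = 0" "?h \<i> \<i> = 0"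
      using trace_free_degenerate_form by blast+
    then have h0: "?h b c = 0" for b c
      using hl[of b c] hr[of 1 c] hr[of \<i> c] sym by simp
    obtain b where b: "b \<noteq> 0" "\<And>c. ?h b c = k * ?g b c"
      using nonflat(1) unfolding second_form_eigenvalue_def by blast
    then have "k * ?g b b = 0" using h0 by metis
    with pos[OF b(1)] nonflat(2) show False by simp
  qed
qed

lemma minimal_graph:
  assumes V: "open V" "V \<subseteq> N \<epsilon>" and F: "smooth_on V F" and \<rho>: "smooth_on V \<rho>"
    and Y: "smooth_on V Y" "\<And>\<zeta>. \<zeta> \<in> V \<Longrightarrow> Y \<zeta> = tang \<zeta> (F \<zeta>) + \<rho> \<zeta> *\<^sub>R dir \<zeta>"
    and normal: "\<And>w a. w \<in> V \<Longrightarrow> amb \<epsilon> (frechet_derivative Y (at w) a) (dir w) = 0"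
    and pos: "\<And>w a. w \<in> V \<Longrightarrow> a \<noteq> 0 \<Longrightarrow> first_form \<epsilon> Y w a a > 0"
    and minimal: "\<And>w. w \<in> V \<Longrightarrow> mean_curvature \<epsilon> Y w (dir w) = 0"
    and \<xi>: "\<xi> \<in> V"
  shows "minimal_equation F \<xi> \<and> wirt (\<lambda>w. cnj (F w)) \<xi> \<noteq> 0"
proof -
  have gradient: "frechet_derivative \<rho> (at \<zeta>) a = 4 * \<epsilon> / (conf \<zeta>)\<^sup>2 * (F \<zeta> \<bullet> a)" (is ?A)
    and height: "wirt F \<zeta> = 2 * of_real \<epsilon> * cnj \<zeta> * F \<zeta> / of_real (conf \<zeta>) - of_real (\<rho> \<zeta>)" (is ?B)
    and immersed: "wirt_bar F \<zeta> \<noteq> 0" (is ?C)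
    if \<zeta>: "\<zeta> \<in> V" for \<zeta> a
  proof -
    let ?D = "frechet_derivative Y (at \<zeta>)"
    let ?g = "first_form \<epsilon> Y \<zeta>"
    let ?h = "second_form \<epsilon> Y \<zeta> (dir \<zeta>)"
    have c: "conf \<zeta> \<noteq> 0" using conf_ne V(2) \<zeta> by blast
    define \<kappa> where "\<kappa> = of_real (\<rho> \<zeta>) - 2 * of_real \<epsilon> * cnj \<zeta> * F \<zeta> / of_real (conf \<zeta>)"
    define B where "B = (\<lambda>a. frechet_derivative F (at \<zeta>) a + \<kappa> * a)"
    have "(Y has_derivative (\<lambda>a. tang \<zeta> (B a) +
        (frechet_derivative \<rho> (at \<zeta>) a - 4 * \<epsilon> / (conf \<zeta>)\<^sup>2 * (F \<zeta> \<bullet> a)) *\<^sub>R dir \<zeta>)) (at \<zeta>)"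
      unfolding B_def \<kappa>_def
      by (rule has_derivative_transform_within_open[OF has_derivative_line_surface[OF c
            smooth_on_has_derivative[OF F \<zeta>] smooth_on_has_derivative[OF \<rho> \<zeta>]] V(1) \<zeta>])
         (simp add: Y(2))
    from frechet_derivative_eqI[OF this]
    have D0: "?D a = tang \<zeta> (B a) +
        (frechet_derivative \<rho> (at \<zeta>) a - 4 * \<epsilon> / (conf \<zeta>)\<^sup>2 * (F \<zeta> \<bullet> a)) *\<^sub>R dir \<zeta>" for a
      by simp
    have orth: "(frechet_derivative \<rho> (at \<zeta>) a - 4 * \<epsilon> / (conf \<zeta>)\<^sup>2 * (F \<zeta> \<bullet> a)) * \<epsilon> = 0" for a
      using normal[OF \<zeta>, of a] unfolding D0 by (simp add: amb_simps amb_tang_dir amb_dir_dir c)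
    have grad: "frechet_derivative \<rho> (at \<zeta>) a = 4 * \<epsilon> / (conf \<zeta>)\<^sup>2 * (F \<zeta> \<bullet> a)" for a
    proof -
      have "\<epsilon> \<noteq> 0" using sign by auto
      with orth[of a] show ?thesis by simp
    qed
    then show ?A .
    have D: "?D a = tang \<zeta> (B a)" for a
      unfolding D0 by (simp add: grad)
    define m where "m = 4 / (conf \<zeta>)\<^sup>2"
    have m: "m \<noteq> 0" using c by (simp add: m_def)
    have g: "?g a b = m * (B a \<bullet> B b)" for a b
      by (simp add: first_form_def D amb_tang_tang c m_def)
    have h: "?h a b = - (m * (B b \<bullet> a))" for a b
      using second_form_gauss[OF V(1) Y(1) \<zeta> has_derivative_ident c normal, of a b]
      by (simp add: D amb_tang_tang c m_def)
    have inj: "B a \<noteq> 0" if "a \<noteq> 0" for a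
      using pos[OF \<zeta> that] unfolding g by auto
    \<comment> \<open>Together with \<open>sym\<close> below, B is the matrix with rows (p, q) and
      (q, s).\<close>
    define p q s where "p = Re (B 1)" and "q = Im (B 1)" and "s = Im (B \<i>)"
    have sym: "Re (B \<i>) = q"
      using second_form_symmetric[OF V(1) Y(1) \<zeta>, of "dir \<zeta>" \<i> 1] m
      by (simp add: h q_def inner_complex_def)
    have tr: "?h 1 1 * ?g \<i> \<i> - 2 * ?h 1 \<i> * ?g 1 \<i> + ?h \<i> \<i> * ?g 1 1 = 0"
      using mean_curvature_zero_iff[OF smooth_on_imp_differentiable[OF Y(1) \<zeta>] pos[OF \<zeta>]]
        minimal[OF \<zeta>] by blast
    \<comment> \<open>The first form is m B^2 and the second is - m B, so their trace expression is
      - m^2 times the trace times the determinant of B.\<close>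
    have "m * m * ((p + s) * (p * s - q * q)) = 0"
      using tr unfolding h g inner_complex_def p_def[symmetric] q_def[symmetric] s_def[symmetric] sym
      by simp algebra
    then have "p + s = 0 \<or> p * s - q * q = 0" using m by simp
    moreover have "p * s - q * q \<noteq> 0"
    proof
      assume 0: "p * s - q * q = 0"
      have lB: "B a = Re a *\<^sub>R B 1 + Im a *\<^sub>R B \<i>" for a
      proof -
        have l: "linear (frechet_derivative F (at \<zeta>))"
          using linear_frechet_derivative[OF smooth_on_imp_differentiable[OF F \<zeta>]] .
        have "frechet_derivative F (at \<zeta>) a
            = Re a *\<^sub>R frechet_derivative F (at \<zeta>) 1 + Im a *\<^sub>R frechet_derivative F (at \<zeta>) \<i>"
          by (metis complex_basis linear_add[OF l] linear_cmul[OF l])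
        then show ?thesis unfolding B_def by (simp add: complex_eq_iff algebra_simps)
      qed
      \<comment> \<open>The columns of the adjugate, up to sign, are killed by B when the
        determinant vanishes.\<close>
      have "B (Complex s (- q)) = 0" "B (Complex q (- p)) = 0"
        using 0 sym unfolding lB[of "Complex _ _"]
        by (simp_all add: complex_eq_iff p_def q_def s_def algebra_simps)
      then have "Complex s (- q) = 0" "Complex q (- p) = 0" using inj by blast+
      then have "B 1 = 0" by (simp add: complex_eq_iff p_def q_def)
      then show False using inj[of 1] by simp
    qed
    ultimately have "s = - p" by simp
    \<comment> \<open>Symmetric and trace-free means antilinear: the linear part of B, which is
      \<partial>F + \<kappa>, vanishes, and B 1 is the antilinear coefficient.\<close>
    then have Bi: "B \<i> = - \<i> * B 1"
      using sym by (simp add: complex_eq_iff p_def q_def s_def)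
    have G: "wirt F \<zeta> = - \<kappa>"
      using Bi by (simp add: wirt_def B_def algebra_simps complex_eq_iff)
    then show ?B by (simp add: \<kappa>_def)
    have "wirt_bar F \<zeta> = B 1"
      using Bi by (simp add: wirt_bar_def B_def algebra_simps complex_eq_iff)
    then show ?C using inj[of 1] by simp
  qed
  have "minimal_equation F \<xi>"
    using minimal_equation_gradient[OF V F \<xi> height smooth_on_has_derivative[OF \<rho> \<xi>]]
      gradient[OF \<xi>] by blast
  moreover have "wirt (\<lambda>w. cnj (F w)) \<xi> \<noteq> 0"
    using immersed[OF \<xi>] wirt_cnj[OF smooth_on_imp_differentiable[OF F \<xi>]] by simp
  ultimately show ?thesis by blast
qed

end

section \<open>From the surface to the section\<close>

lemma surface_chart_subset: "surface_chart S U \<phi> \<Longrightarrow> \<phi> ` U \<subseteq> S"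
  unfolding surface_chart_def by (metis openin_imp_subset)

text \<open>Allows a local inverse g of the Gauss map to replace the parameter of a chart.\<close>

lemma surface_chart_compose:
  assumes \<phi>: "surface_chart S U \<phi>" and U': "open U'" "U' \<subseteq> U" and V: "open V"
    and g: "homeomorphism U' V f g" "smooth_on V g" "\<And>y. y \<in> V \<Longrightarrow> inj (frechet_derivative g (at y))"
  shows "surface_chart S V (\<phi> \<circ> g)"
proof -
  obtain \<psi> where U: "open U" "smooth_on U \<phi>" "\<And>u. u \<in> U \<Longrightarrow> inj (frechet_derivative \<phi> (at u))"
    "openin (top_of_set S) (\<phi> ` U)" "homeomorphism U (\<phi> ` U) \<phi> \<psi>"
    using \<phi> unfolding surface_chart_def by blast
  have gV: "g ` V = U'" using g(1) unfolding homeomorphism_def by blast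
  have im: "(\<phi> \<circ> g) ` V = \<phi> ` U'" using gV by (metis image_comp)
  have "smooth_on V (\<phi> \<circ> g)"
    unfolding o_def by (rule smooth_on_compose[OF V U(1) _ g(2) U(2)]) (use gV U'(2) in blast)
  moreover have "inj (frechet_derivative (\<phi> \<circ> g) (at y))" if y: "y \<in> V" for y
  proof -
    have gy: "g y \<in> U" using y gV U'(2) by blast
    have "frechet_derivative (\<phi> \<circ> g) (at y)
        = frechet_derivative \<phi> (at (g y)) \<circ> frechet_derivative g (at y)"
      by (rule frechet_derivative_compose)
        (use smooth_on_imp_differentiable g(2) y U(2) gy in blast)+
    then show ?thesis using inj_compose[OF U(3)[OF gy] g(3)[OF y]] by simp
  qed
  moreover have "openin (top_of_set S) (\<phi> ` U')"
  proof -
    have "openin (top_of_set (\<phi> ` U)) (\<phi> ` U')"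
      by (rule homeomorphism_imp_open_map[OF U(5)])
         (use U' in \<open>auto intro: open_subset\<close>)
    then show ?thesis using U(4) openin_trans by blast
  qed
  moreover have "homeomorphism V (\<phi> ` U') (\<phi> \<circ> g) (f \<circ> \<psi>)"
    by (rule homeomorphism_compose[OF homeomorphism_symD[OF g(1)] homeomorphism_of_subsets[OF U(5)]])
       (use U'(2) in auto)
  ultimately show ?thesis
    unfolding surface_chart_def im using V by blast
qed

text \<open>The graph and L are both 2-dimensional: read in a chart of L, the graph is a continuous
  injective image of an open subset of the plane, hence open by invariance of domain.\<close>

lemma open_graph_in_surface:
  assumes L: "embedded_surface L" and V: "open V" "continuous_on V F" "\<xi> \<in> V"
    and graph: "section_graph V F \<subseteq> L"
  obtains W V' where "open W" "open V'" "V' \<subseteq> V" "\<xi> \<in> V'" "L \<inter> W = section_graph V' F"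
proof -
  let ?G = "\<lambda>w. (w, F w)"
  have "?G \<xi> \<in> L" using graph V(3) unfolding section_graph_def by blast
  then obtain U \<phi> where \<phi>: "surface_chart L U \<phi>" "?G \<xi> \<in> \<phi> ` U"
    using L unfolding embedded_surface_def by meson
  obtain \<psi> where U: "open U" "?G \<xi> \<in> \<phi> ` U" "openin (top_of_set L) (\<phi> ` U)"
    "homeomorphism U (\<phi> ` U) \<phi> \<psi>"
    using \<phi> unfolding surface_chart_def by auto
  obtain T where T: "open T" "\<phi> ` U = L \<inter> T"
    using U(3) openin_open by blast
  \<comment> \<open>Shrinks the graph until it lies in a single chart.\<close>
  define V' where "V' = V \<inter> ?G -` T"
  have G: "continuous_on V ?G" by (intro continuous_intros V)
  have V': "open V'" "V' \<subseteq> V" "\<xi> \<in> V'"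
    using continuous_open_preimage[OF G V(1) T(1)] U(2) T(2) V(3) by (auto simp: V'_def)
  have GV: "?G ` V' \<subseteq> \<phi> ` U"
    unfolding T(2) using graph V'(2) by (auto simp: V'_def section_graph_def)
  have \<psi>: "\<phi> (\<psi> x) = x" if "x \<in> \<phi> ` U" for x
    using U(4) that unfolding homeomorphism_def by blast
  have "continuous_on V' (\<lambda>w. \<psi> (?G w))"
    by (rule continuous_on_compose2[OF homeomorphism_cont2[OF U(4)] continuous_on_subset[OF G V'(2)] GV])
  moreover have "inj_on (\<lambda>w. \<psi> (?G w)) V'"
  proof (rule inj_onI)
    fix x y assume "x \<in> V'" "y \<in> V'" "\<psi> (?G x) = \<psi> (?G y)"
    moreover have "?G x \<in> \<phi> ` U" "?G y \<in> \<phi> ` U" using GV calculation(1,2) by auto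
    ultimately have "?G x = ?G y" using \<psi> by metis
    then show "x = y" by simp
  qed
  ultimately have op: "open ((\<lambda>w. \<psi> (?G w)) ` V')"
    using invariance_of_domain_gen[OF V'(1)] by blast
  have "openin (top_of_set (\<phi> ` U)) (\<phi> ` (\<lambda>w. \<psi> (?G w)) ` V')"
  proof (rule homeomorphism_imp_open_map[OF U(4)])
    have "(\<lambda>w. \<psi> (?G w)) ` V' \<subseteq> U"
      using GV homeomorphism_image2[OF U(4)] by auto
    then show "openin (top_of_set U) ((\<lambda>w. \<psi> (?G w)) ` V')"
      using op open_subset by blast
  qed
  moreover have "\<phi> ` (\<lambda>w. \<psi> (?G w)) ` V' = ?G ` V'"
  proof -
    have "\<phi> (\<psi> (?G w)) = ?G w" if "w \<in> V'" for w
      by (rule \<psi>) (use GV that in blast)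
    then show ?thesis unfolding image_image by (simp cong: image_cong)
  qed
  ultimately have "openin (top_of_set L) (?G ` V')"
    using U(3) openin_trans by metis
  then obtain W where "open W" "?G ` V' = L \<inter> W"
    using openin_open by metis
  moreover have "?G ` V' = section_graph V' F"
    by (auto simp: section_graph_def)
  ultimately show ?thesis using that V' by metis
qed

context sign
begin

lemma line_point_diff:
  assumes "conf (fst p) \<noteq> 0"
  shows "line_point \<epsilon> p r - line_point \<epsilon> p s = (r - s) *\<^sub>R dir (fst p)"
  by (simp add: line_point_eq[OF assms] scaleR_diff_left)

text \<open>The vector product of the partial derivatives is \<open>\<mu>\<close> times the unit normal; only \<open>\<mu>\<^sup>2\<close>
  is visibly smooth, and the continuity of the normal transfers this to \<open>\<mu>\<close>.\<close>

lemma smooth_gauss_map: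
  assumes U: "open U" "smooth_on U Y" and \<nu>: "continuous_on U \<nu>" "\<And>w. w \<in> U \<Longrightarrow> conf (\<nu> w) \<noteq> 0"
    and normal: "\<And>w a. w \<in> U \<Longrightarrow> amb \<epsilon> (frechet_derivative Y (at w) a) (dir (\<nu> w)) = 0"
    and pos: "\<And>w a. w \<in> U \<Longrightarrow> a \<noteq> 0 \<Longrightarrow> first_form \<epsilon> Y w a a > 0"
  shows "smooth_on U \<nu>"
proof -
  let ?D = "\<lambda>a w. frechet_derivative Y (at w) a"
  define m where "m = (\<lambda>w. normal_cross (?D 1 w) (?D \<i> w))"
  define \<mu> where "\<mu> = (\<lambda>w. \<epsilon> * amb \<epsilon> (m w) (dir (\<nu> w)))"
  have sm: "smooth_on U m"
    unfolding m_def normal_cross_def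
    by (intro smooth_intros smooth_on_frechet_derivative U)
  have m: "m w = \<mu> w *\<^sub>R dir (\<nu> w) \<and> \<mu> w \<noteq> 0" if w: "w \<in> U" for w
  proof -
    note c = \<nu>(2)[OF w]
    have tan: "\<exists>b. ?D a w = tang (\<nu> w) b" for a
    proof -
      obtain b s where b: "?D a w = tang (\<nu> w) b + s *\<^sub>R dir (\<nu> w)"
        using frame_cases[OF c] .
      have "s * \<epsilon> = 0"
        using normal[OF w, of a] unfolding b by (simp add: amb_simps amb_tang_dir amb_dir_dir c)
      then have "s = 0" using sign by auto
      then show ?thesis using b by auto
    qed
    obtain b1 b2 where b: "?D 1 w = tang (\<nu> w) b1" "?D \<i> w = tang (\<nu> w) b2"
      using tan by meson
    define k where "k = 4 * \<epsilon> / (conf (\<nu> w))\<^sup>2 * Im (cnj b1 * b2)"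
    have mk: "m w = k *\<^sub>R dir (\<nu> w)"
      unfolding m_def b k_def by (rule normal_cross_tang[OF c])
    have "\<mu> w = k * (\<epsilon> * \<epsilon>)"
      unfolding \<mu>_def mk by (simp add: amb_simps amb_dir_dir c)
    then have \<mu>k: "\<mu> w = k" using sign_sq by simp
    have "Im (cnj b1 * b2) \<noteq> 0"
    proof
      assume 0: "Im (cnj b1 * b2) = 0"
      have l: "linear (\<lambda>a. ?D a w)"
        using linear_frechet_derivative[OF smooth_on_imp_differentiable[OF U(2) w]] .
      have e: "?D a w = tang (\<nu> w) (Re a *\<^sub>R b1 + Im a *\<^sub>R b2)" for a
      proof -
        have "?D a w = Re a *\<^sub>R ?D 1 w + Im a *\<^sub>R ?D \<i> w"
          by (metis complex_basis linear_add[OF l] linear_cmul[OF l])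
        then show ?thesis by (simp add: b tang_simps)
      qed
      have z: "a = 0" if "Re a *\<^sub>R b1 + Im a *\<^sub>R b2 = 0" for a
      proof (rule ccontr)
        assume "a \<noteq> 0"
        then have "first_form \<epsilon> Y w a a > 0" using pos[OF w] by blast
        then show False unfolding first_form_def e that by (simp add: tang_simps amb_simps)
      qed
      \<comment> \<open>When the area vanishes, these are coefficients of linear relations between
        b1 and b2.\<close>
      have "Complex (Re b2) (- Re b1) = 0" "Complex (Im b2) (- Im b1) = 0"
        by (rule z, use 0 in \<open>simp add: complex_eq_iff algebra_simps\<close>)+
      then have "b1 = 0" by (simp add: complex_eq_iff)
      then show False using z[of 1] by simp
    qed
    then have "k \<noteq> 0" using sign c by (auto simp: k_def)
    with mk \<mu>k show ?thesis by simp
  qed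
  have cd: "continuous_on U (\<lambda>w. dir (\<nu> w))"
  proof (rule continuous_on_compose2[OF _ \<nu>(1), of "{\<xi>. conf \<xi> \<noteq> 0}"])
    show "continuous_on {\<xi>. conf \<xi> \<noteq> 0} dir"
      by (rule continuous_at_imp_continuous_on)
         (auto intro: has_derivative_continuous[OF has_derivative_dir])
  qed (use \<nu>(2) in auto)
  have c\<mu>: "continuous_on U \<mu>"
    unfolding \<mu>_def
    by (intro continuous_on_mult_left bounded_bilinear.continuous_on[OF bounded_bilinear_amb]
        smooth_on_continuous[OF sm] cd)
  \<comment> \<open>\<open>amb \<epsilon> (m w) (m w)\<close> is \<epsilon> times the square of
    \<mu>, and it is built from derivatives of Y alone.\<close>
  have s2: "smooth_on U (\<lambda>w. (\<mu> w)\<^sup>2)"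
  proof (rule smooth_on_cong[OF U(1)])
    show "smooth_on U (\<lambda>w. \<epsilon> * amb \<epsilon> (m w) (m w))"
      by (intro smooth_intros smooth_on_bilinear[OF bounded_bilinear_amb] sm U)
    fix w assume w: "w \<in> U"
    have "amb \<epsilon> (m w) (m w) = \<mu> w * (\<mu> w * \<epsilon>)"
    proof -
      have e: "m w = \<mu> w *\<^sub>R dir (\<nu> w)" using m[OF w] by blast
      show ?thesis unfolding e by (simp add: amb_simps amb_dir_dir \<nu>(2)[OF w])
    qed
    then show "\<epsilon> * amb \<epsilon> (m w) (m w) = (\<mu> w)\<^sup>2"
      using sign by (auto simp: power2_eq_square)
  qed
  have s\<mu>: "smooth_on U \<mu>"
    using Ck_on_continuous_sqrt[OF U(1) c\<mu>] m s2 unfolding smooth_on_def by blast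
  have sd: "smooth_on U (\<lambda>w. dir (\<nu> w))"
  proof (rule smooth_on_cong[OF U(1)])
    show "smooth_on U (\<lambda>w. (1 / \<mu> w) *\<^sub>R m w)"
      by (intro smooth_intros s\<mu> sm U) (use m in auto)
  qed (use m in auto)
  show ?thesis
  proof (rule smooth_on_cong[OF U(1)])
    \<comment> \<open>Stereographic projection recovers \<nu>; the denominator is 2 / w, hence
      nonzero.\<close>
    show "smooth_on U (\<lambda>w. (1 / (1 + snd (dir (\<nu> w)))) *\<^sub>R fst (dir (\<nu> w)))"
      by (intro smooth_intros sd U) (use \<nu>(2) in \<open>auto simp: dir_def\<close>)
    show "(1 / (1 + snd (dir (\<nu> w)))) *\<^sub>R fst (dir (\<nu> w)) = \<nu> w" if "w \<in> U" for w
      using dir_inverse[OF \<nu>(2)[OF that]] by (simp add: divide_inverse)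
  qed
qed

lemma section_of_minimal_surface:
  fixes M :: "'a::euclidean_space set"
  assumes L: "embedded_surface L" "L \<subseteq> TN \<epsilon>"
    and X: "immersed_surface \<epsilon> M X" "zero_mean_curvature \<epsilon> M X" "\<forall>p\<in>M. \<not> flat_point \<epsilon> M X p"
    and orth: "orthogonal_to \<epsilon> L M X" and \<gamma>: "\<gamma> \<in> L"
  shows "\<exists>W U F. open W \<and> \<gamma> \<in> W \<and> local_section \<epsilon> U F \<and> L \<inter> W = section_graph U F \<and>
    (\<forall>\<xi>\<in>U. minimal_equation F \<xi> \<and> wirt (\<lambda>w. cnj (F w)) \<xi> \<noteq> 0)"
proof -
  obtain \<nu> where \<nu>: "continuous_on M \<nu>" "\<nu> ` M = L" "\<And>p. p \<in> M \<Longrightarrow> X p \<in> line_of \<epsilon> (\<nu> p)"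
    and orth1: "\<And>U \<phi> u a p q. surface_chart M U \<phi> \<Longrightarrow> u \<in> U \<Longrightarrow> p \<in> line_of \<epsilon> (\<nu> (\<phi> u)) \<Longrightarrow>
      q \<in> line_of \<epsilon> (\<nu> (\<phi> u)) \<Longrightarrow> amb \<epsilon> (p - q) (frechet_derivative (X \<circ> \<phi>) (at u) a) = 0"
    using orth unfolding orthogonal_to_def by metis
  have in_M: "\<phi> u \<in> M" if "surface_chart M U \<phi>" "u \<in> U" for U \<phi> u
    using surface_chart_subset[OF that(1)] that(2) by blast
  have inN: "fst (\<nu> p) \<in> N \<epsilon>" if "p \<in> M" for p
    using \<nu>(2) L(2) that by (fastforce simp: TN_def)
  have c: "conf (fst (\<nu> p)) \<noteq> 0" if "p \<in> M" for p
    using conf_ne inN that by blast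
  have normal: "amb \<epsilon> (frechet_derivative (X \<circ> \<phi>) (at u) a) (dir (fst (\<nu> (\<phi> u)))) = 0"
    if "surface_chart M U \<phi>" "u \<in> U" for U \<phi> u a
  proof -
    \<comment> \<open>Points of the line with parameters 1 and 0 differ exactly by
      \<open>dir\<close>.\<close>
    have "amb \<epsilon> (line_point \<epsilon> (\<nu> (\<phi> u)) 1 - line_point \<epsilon> (\<nu> (\<phi> u)) 0)
        (frechet_derivative (X \<circ> \<phi>) (at u) a) = 0"
      by (rule orth1[OF that]) (auto simp: line_of_def)
    then show ?thesis
      unfolding line_point_diff[OF c[OF in_M[OF that]]] by (simp add: amb_commute)
  qed
  have smX: "smooth_on U (X \<circ> \<phi>)" if "surface_chart M U \<phi>" for U \<phi>
    using X(1) that unfolding immersed_surface_def by blast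
  have pos: "first_form \<epsilon> (X \<circ> \<phi>) u a a > 0" if "surface_chart M U \<phi>" "u \<in> U" "a \<noteq> 0" for U \<phi> u a
    using X(1) that unfolding immersed_surface_def by blast
  have un: "unit_normal \<epsilon> (X \<circ> \<phi>) u (dir (fst (\<nu> (\<phi> u))))"
    if "surface_chart M U \<phi>" "u \<in> U" for U \<phi> u
    unfolding unit_normal_def
    using normal[OF that] amb_dir_dir[OF c[OF in_M[OF that]]] amb_commute by metis
  have mc: "mean_curvature \<epsilon> (X \<circ> \<phi>) u (dir (fst (\<nu> (\<phi> u)))) = 0"
    if "surface_chart M U \<phi>" "u \<in> U" for U \<phi> u
    using X(2) un[OF that] that unfolding zero_mean_curvature_def by blast
  obtain p where p: "p \<in> M" "\<nu> p = \<gamma>" using \<nu>(2) \<gamma> by blast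
  have "embedded_surface M" using X(1) unfolding immersed_surface_def by blast
  then obtain U \<phi> where \<phi>: "surface_chart M U \<phi>" and "p \<in> \<phi> ` U"
    using p(1) unfolding embedded_surface_def by meson
  then obtain u where u: "u \<in> U" "\<phi> u = p" by blast
  have oU: "open U" and s\<phi>: "smooth_on U \<phi>" using \<phi> unfolding surface_chart_def by auto
  define f where "f = (\<lambda>w. fst (\<nu> (\<phi> w)))"
  have cf: "continuous_on U f"
    unfolding f_def
    by (intro continuous_on_fst continuous_on_compose2[OF \<nu>(1) smooth_on_continuous[OF s\<phi>]]
        surface_chart_subset \<phi>)
  have cne: "conf (f w) \<noteq> 0" if "w \<in> U" for w
    unfolding f_def using c in_M[OF \<phi> that] by blast
  have nf: "amb \<epsilon> (frechet_derivative (X \<circ> \<phi>) (at w) a) (dir (f w)) = 0" if "w \<in> U" for w a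
    unfolding f_def by (rule normal[OF \<phi> that])
  have sf: "smooth_on U f"
    by (rule smooth_gauss_map[OF oU smX[OF \<phi>] cf cne nf pos[OF \<phi>]])
  \<comment> \<open>\<open>flat_point\<close> asks for some chart and unit normal with only zero
    eigenvalues, so its negation can be used with the present chart and the normal
    \<open>dir (f u)\<close>.\<close>
  obtain k where k: "second_form_eigenvalue \<epsilon> (X \<circ> \<phi>) u (dir (f u)) k" "k \<noteq> 0"
    using X(3) p(1) \<phi> u un[OF \<phi> u(1)] unfolding flat_point_def f_def by blast
  have mcf: "mean_curvature \<epsilon> (X \<circ> \<phi>) u (dir (f u)) = 0"
    unfolding f_def by (rule mc[OF \<phi> u(1)])
  have "inj (frechet_derivative f (at u))"
    by (rule gauss_map_immersion[OF oU smX[OF \<phi>] u(1) smooth_on_has_derivative[OF sf u(1)]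
          cne[OF u(1)] nf pos[OF \<phi> u(1)] mcf k])
  then obtain U' V g where g: "open U'" "U' \<subseteq> U" "u \<in> U'" "open V" "homeomorphism U' V f g"
    "smooth_on V g" "\<And>y. y \<in> V \<Longrightarrow> inj (frechet_derivative g (at y))"
    using smooth_inverse_function[OF oU sf u(1)] by metis
  \<comment> \<open>In this chart the Gauss map is the identity, so the normal lines form the graph
    of a section.\<close>
  define \<theta> where "\<theta> = \<phi> \<circ> g"
  have \<theta>: "surface_chart M V \<theta>"
    unfolding \<theta>_def by (rule surface_chart_compose[OF \<phi> g(1,2,4,5,6,7)])
  have \<nu>\<theta>: "fst (\<nu> (\<theta> w)) = w" if "w \<in> V" for w
    using g(5) that unfolding \<theta>_def f_def homeomorphism_def by simp
  define F where "F = (\<lambda>w. snd (\<nu> (\<theta> w)))"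
  \<comment> \<open>Pairing a point of the line with \<open>dir\<close> gives \<epsilon> times its
    parameter; the factor \<epsilon> undoes this since \<epsilon>^2 = 1. The formula shows the
    smoothness of \<rho>.\<close>
  define \<rho> where "\<rho> = (\<lambda>w. \<epsilon> * amb \<epsilon> ((X \<circ> \<theta>) w) (dir w))"
  have \<nu>F: "\<nu> (\<theta> w) = (w, F w)" if "w \<in> V" for w
    using \<nu>\<theta>[OF that] by (simp add: F_def prod_eq_iff)
  have VN: "V \<subseteq> N \<epsilon>"
    using \<nu>\<theta> inN in_M[OF \<theta>] by (metis subsetI)
  have cV: "conf w \<noteq> 0" if "w \<in> V" for w
    using VN conf_ne that by blast
  have line: "(X \<circ> \<theta>) w = line_point \<epsilon> (w, F w) (\<rho> w)" if w: "w \<in> V" for w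
  proof -
    obtain r where r: "(X \<circ> \<theta>) w = line_point \<epsilon> (w, F w) r"
      using \<nu>(3)[OF in_M[OF \<theta> w]] unfolding \<nu>F[OF w] line_of_def by auto
    have "\<rho> w = \<epsilon> * (r * \<epsilon>)"
      unfolding \<rho>_def r
      by (simp add: line_point_eq cV[OF w] amb_simps amb_tang_dir amb_dir_dir)
    then show ?thesis using r sign by auto
  qed
  have smY: "smooth_on V (X \<circ> \<theta>)" by (rule smX[OF \<theta>])
  have sF: "smooth_on V F"
  proof (rule smooth_on_cong[OF g(4)])
    let ?Y = "X \<circ> \<theta>"
    show "smooth_on V (\<lambda>w. (fst (?Y w) - 2 * of_real (snd (?Y w)) * w
        - of_real \<epsilon> * cnj (fst (?Y w)) * w\<^sup>2) / 2)"
      by (intro smooth_intros smY g(4)) auto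
  qed (use line_point_inverse[OF cV line] in simp)
  have s\<rho>: "smooth_on V \<rho>"
    unfolding \<rho>_def dir_def conf_def
    by (intro smooth_intros smY g(4) smooth_on_bilinear[OF bounded_bilinear_amb])
       (use cV in \<open>simp add: conf_def\<close>)
  have eq: "minimal_equation F w \<and> wirt (\<lambda>w. cnj (F w)) w \<noteq> 0" if w: "w \<in> V" for w
  proof (rule minimal_graph[OF g(4) VN sF s\<rho> smY _ _ pos[OF \<theta>] _ w])
    show "(X \<circ> \<theta>) \<zeta> = tang \<zeta> (F \<zeta>) + \<rho> \<zeta> *\<^sub>R dir \<zeta>" if "\<zeta> \<in> V" for \<zeta>
      using line[OF that] by (simp add: line_point_eq cV[OF that])
    show "amb \<epsilon> (frechet_derivative (X \<circ> \<theta>) (at \<zeta>) a) (dir \<zeta>) = 0" if "\<zeta> \<in> V" for \<zeta> a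
      using normal[OF \<theta> that] \<nu>\<theta>[OF that] by simp
    show "mean_curvature \<epsilon> (X \<circ> \<theta>) \<zeta> (dir \<zeta>) = 0" if "\<zeta> \<in> V" for \<zeta>
      using mc[OF \<theta> that] \<nu>\<theta>[OF that] by simp
  qed
  have fu: "f u \<in> V" "g (f u) = u"
    using g(3,5) unfolding homeomorphism_def by auto
  have \<gamma>F: "\<gamma> = (f u, F (f u))"
    using \<nu>F[OF fu(1)] fu(2) u(2) p(2) by (simp add: \<theta>_def)
  have "section_graph V F \<subseteq> L"
  proof
    fix x assume "x \<in> section_graph V F"
    then obtain w where w: "w \<in> V" "x = (w, F w)" by (auto simp: section_graph_def)
    have "\<nu> (\<theta> w) \<in> \<nu> ` M" using in_M[OF \<theta> w(1)] by blast
    then show "x \<in> L" using \<nu>F[OF w(1)] \<nu>(2) w(2) by simp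
  qed
  then obtain W V' where W: "open W" "open V'" "V' \<subseteq> V" "f u \<in> V'" "L \<inter> W = section_graph V' F"
    using open_graph_in_surface[OF L(1) g(4) smooth_on_continuous[OF sF] fu(1)] by metis
  moreover have "\<gamma> \<in> W"
    using W(4,5) \<gamma>F unfolding section_graph_def by blast
  moreover have "local_section \<epsilon> V' F"
    unfolding local_section_def using W(2,3) VN smooth_on_subset[OF sF] by blast
  ultimately show ?thesis using eq by blast
qed

end

section \<open>From the section to the surface\<close>

lemma section_graph_chart:
  assumes U: "open U" "smooth_on U F" and W: "open W" "L \<inter> W = section_graph U F"
  shows "surface_chart L U (\<lambda>w. (w, F w))"
  unfolding surface_chart_def
proof (intro conjI ballI)
  let ?G = "\<lambda>w. (w, F w)"
  show sG: "smooth_on U ?G" by (intro smooth_intros U)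
  show "inj (frechet_derivative ?G (at u))" if u: "u \<in> U" for u
  proof -
    have "(?G has_derivative (\<lambda>a. (a, frechet_derivative F (at u) a))) (at u)"
      by (rule has_derivative_Pair[OF has_derivative_ident smooth_on_has_derivative[OF U(2) u]])
    from frechet_derivative_eqI[OF this] show ?thesis
      by (auto intro: injI)
  qed
  have "?G ` U = L \<inter> W" unfolding W(2) section_graph_def by blast
  then show "openin (top_of_set L) (?G ` U)"
    using W(1) openin_open by metis
  have "homeomorphism U (?G ` U) ?G fst"
    unfolding homeomorphism_def
    using smooth_on_continuous[OF sG] by (force intro: continuous_on_fst continuous_on_id)
  then show "\<exists>\<psi>. homeomorphism U (?G ` U) ?G \<psi>" by blast
qed (rule U)

context sign
begin

text \<open>The choice of \<rho> that makes B antilinear. For a Lagrangian graph the bracket is real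
  by \<open>lagrangian_section\<close>, so \<open>Re\<close> only adjusts the type.\<close>

definition height :: "(complex \<Rightarrow> complex) \<Rightarrow> complex \<Rightarrow> real" where
  "height F \<xi> = Re (2 * of_real \<epsilon> * cnj \<xi> * F \<xi> / of_real (conf \<xi>) - wirt F \<xi>)"

lemma wirt_e2u:
  assumes "conf \<xi> \<noteq> 0"
  shows "wirt (e2u \<epsilon>) \<xi> = - (8 * of_real \<epsilon> * cnj \<xi> / of_real (conf \<xi>) ^ 3)"
proof -
  let ?K = "\<lambda>\<xi>. 1 / complex_of_real (conf \<xi>)"
  have e2u: "e2u \<epsilon> = (\<lambda>\<xi>. 4 * (?K \<xi> * ?K \<xi>))"
    by (simp add: e2u_def fun_eq_iff power2_eq_square flip: conf_complex)
  have d: "((\<lambda>\<xi>. 4 * (?K \<xi> * ?K \<xi>)) has_derivative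
      (\<lambda>v. 4 * (?K \<xi> * (- of_real (2 * \<epsilon> * (\<xi> \<bullet> v)) / of_real (conf \<xi>) ^ 2)
        + - of_real (2 * \<epsilon> * (\<xi> \<bullet> v)) / of_real (conf \<xi>) ^ 2 * ?K \<xi>))) (at \<xi>)"
    by (intro has_derivative_mult_right has_derivative_mult has_derivative_inverse_conf assms)
  have "wirt (e2u \<epsilon>) \<xi> = (\<lambda>d. (d 1 - \<i> * d \<i>) / 2)
      (\<lambda>v. 4 * (?K \<xi> * (- of_real (2 * \<epsilon> * (\<xi> \<bullet> v)) / of_real (conf \<xi>) ^ 2)
        + - of_real (2 * \<epsilon> * (\<xi> \<bullet> v)) / of_real (conf \<xi>) ^ 2 * ?K \<xi>))"
    unfolding e2u by (rule wirt_eqI[OF d])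
  also have "\<dots> = - (8 * of_real \<epsilon> * (of_real (\<xi> \<bullet> 1) - \<i> * of_real (\<xi> \<bullet> \<i>)) / of_real (conf \<xi>) ^ 3)"
    using assms by (simp add: field_simps power2_eq_square power3_eq_cube)
  also have "of_real (\<xi> \<bullet> 1) - \<i> * of_real (\<xi> \<bullet> \<i>) = cnj \<xi>"
    by (simp add: inner_complex_def complex_eq_iff)
  finally show ?thesis .
qed

text \<open>On the tangent vectors of the graph over 1 and \<i> the symplectic form is a nonzero
  multiple of the imaginary part of 2 \<epsilon> cnj \<xi> F / w - \<partial>F.\<close>

lemma lagrangian_section:
  assumes L: "lagrangian \<epsilon> L" and U: "open U" "U \<subseteq> N \<epsilon>" "smooth_on U F"
    and W: "open W" "L \<inter> W = section_graph U F" and \<xi>: "\<xi> \<in> U"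
  shows "wirt F \<xi> = 2 * of_real \<epsilon> * cnj \<xi> * F \<xi> / of_real (conf \<xi>) - of_real (height F \<xi>)"
proof -
  let ?G = "\<lambda>w. (w, F w)"
  let ?d = "frechet_derivative F (at \<xi>)"
  have c: "conf \<xi> \<noteq> 0" using conf_ne U(2) \<xi> by blast
  have "(?G has_derivative (\<lambda>a. (a, ?d a))) (at \<xi>)"
    by (rule has_derivative_Pair[OF has_derivative_ident smooth_on_has_derivative[OF U(3) \<xi>]])
  note dG = frechet_derivative_eqI[OF this]
  have "symp \<epsilon> (?G \<xi>) (frechet_derivative ?G (at \<xi>) 1) (frechet_derivative ?G (at \<xi>) \<i>) = 0"
    using L section_graph_chart[OF U(1,3) W] \<xi> unfolding lagrangian_def by blast
  then have "Re (e2u \<epsilon> \<xi> * (?d 1 * cnj \<i> - ?d \<i> * cnj 1)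
     + F \<xi> * wirt (e2u \<epsilon>) \<xi> * (1 * cnj \<i> - \<i> * cnj 1)) = 0"
    unfolding symp_def dG by simp
  moreover have "?d 1 * cnj \<i> - ?d \<i> * cnj 1 = - 2 * \<i> * wirt F \<xi>"
    by (simp add: wirt_def algebra_simps)
  moreover have "e2u \<epsilon> \<xi> = 4 / of_real (conf \<xi>) ^ 2"
    by (simp add: e2u_def conf_complex)
  moreover have "4 / of_real (conf \<xi>) ^ 2 * (- 2 * \<i> * wirt F \<xi>)
      + F \<xi> * - (8 * of_real \<epsilon> * cnj \<xi> / of_real (conf \<xi>) ^ 3) * (1 * cnj \<i> - \<i> * cnj 1)
    = (8 / conf \<xi> ^ 2) *\<^sub>R (\<i> * (2 * of_real \<epsilon> * cnj \<xi> * F \<xi> / of_real (conf \<xi>) - wirt F \<xi>))"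
    using c by (simp add: scaleR_conv_of_real field_simps power2_eq_square power3_eq_cube)
  ultimately have R: "Re ((8 / conf \<xi> ^ 2) *\<^sub>R (\<i> * (2 * of_real \<epsilon> * cnj \<xi> * F \<xi> / of_real (conf \<xi>) - wirt F \<xi>))) = 0"
    unfolding wirt_e2u[OF c] by metis
  have Im0: "Im Q = 0" if "Re (k *\<^sub>R (\<i> * Q)) = 0" "k \<noteq> 0" for Q k
    using that by simp
  have "Im (2 * of_real \<epsilon> * cnj \<xi> * F \<xi> / of_real (conf \<xi>) - wirt F \<xi>) = 0"
    by (rule Im0[OF R]) (use c in simp)
  then have "of_real (height F \<xi>) = 2 * of_real \<epsilon> * cnj \<xi> * F \<xi> / of_real (conf \<xi>) - wirt F \<xi>"
    unfolding height_def by (simp add: complex_eq_iff)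
  then show ?thesis by simp
qed

lemma smooth_conf: "open U \<Longrightarrow> smooth_on U conf"
  unfolding conf_def by (intro smooth_intros)

lemma smooth_height:
  assumes U: "open U" "U \<subseteq> N \<epsilon>" "smooth_on U F"
  shows "smooth_on U (height F)"
  unfolding height_def
  by (intro smooth_intros smooth_conf U) (use conf_ne U(2) in auto)

lemma smooth_line_surface:
  assumes U: "open U" "U \<subseteq> N \<epsilon>" "smooth_on U F" "smooth_on U \<rho>"
  shows "smooth_on U (\<lambda>\<zeta>. tang \<zeta> (F \<zeta>) + \<rho> \<zeta> *\<^sub>R dir \<zeta>)"
  unfolding dir_def tang_def
  by (intro smooth_intros smooth_conf U) (use conf_ne U(2) in auto)

text \<open>The height cancels the linear part of B, and the differential equation, read as the
  gradient condition, cancels the component along \<open>dir\<close>.\<close>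

lemma minimal_surface_derivative:
  assumes U: "open U" "U \<subseteq> N \<epsilon>" "smooth_on U F"
    and wirt: "\<And>\<zeta>. \<zeta> \<in> U \<Longrightarrow>
      wirt F \<zeta> = 2 * of_real \<epsilon> * cnj \<zeta> * F \<zeta> / of_real (conf \<zeta>) - of_real (height F \<zeta>)"
    and eq: "minimal_equation F \<xi>" and \<xi>: "\<xi> \<in> U"
  shows "((\<lambda>\<zeta>. tang \<zeta> (F \<zeta>) + height F \<zeta> *\<^sub>R dir \<zeta>) has_derivative
    (\<lambda>a. tang \<xi> (wirt_bar F \<xi> * cnj a))) (at \<xi>)"
proof -
  have c: "conf \<xi> \<noteq> 0" using conf_ne U(2) \<xi> by blast
  note d\<rho> = smooth_on_has_derivative[OF smooth_height[OF U] \<xi>]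
  note dF = smooth_on_has_derivative[OF U(3) \<xi>]
  have grad: "frechet_derivative (height F) (at \<xi>) a = 4 * \<epsilon> / (conf \<xi>)\<^sup>2 * (F \<xi> \<bullet> a)" for a
    using minimal_equation_gradient[OF U \<xi> wirt d\<rho>] eq by blast
  have "frechet_derivative F (at \<xi>) a
      + (of_real (height F \<xi>) - 2 * of_real \<epsilon> * cnj \<xi> * F \<xi> / of_real (conf \<xi>)) * a
      = wirt_bar F \<xi> * cnj a" for a
    unfolding derivative_eq_wirt[OF smooth_on_imp_differentiable[OF U(3) \<xi>]] wirt[OF \<xi>]
    by (simp add: algebra_simps)
  then show ?thesis
    using has_derivative_line_surface[OF c dF d\<rho>] by (simp add: grad)
qed

text \<open>The geometric conditions quantify over all charts, so the Gauss map f enters as an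
  arbitrary function of the parameter. The derivative of Z is that of f followed by an antilinear
  map; hence the first form is conformal to the pullback of the flat metric by f.\<close>

lemma anticonformal_surface:
  assumes U: "open U" "smooth_on U Z" "smooth_on U f" "u \<in> U"
    and inj: "inj (frechet_derivative f (at u))"
    and c: "\<And>w. w \<in> U \<Longrightarrow> conf (f w) \<noteq> 0"
    and dZ: "\<And>w a. w \<in> U \<Longrightarrow>
      frechet_derivative Z (at w) a = tang (f w) (\<beta> w * cnj (frechet_derivative f (at w) a))"
    and \<beta>: "\<beta> u \<noteq> 0"
  shows "a \<noteq> 0 \<Longrightarrow> first_form \<epsilon> Z u a a > 0"
    and "unit_normal \<epsilon> Z u n \<Longrightarrow> mean_curvature \<epsilon> Z u n = 0"
    and "unit_normal \<epsilon> Z u n \<Longrightarrow> \<exists>k. second_form_eigenvalue \<epsilon> Z u n k \<and> k \<noteq> 0"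
proof -
  let ?f = "frechet_derivative f (at u)"
  let ?g = "first_form \<epsilon> Z u"
  define b where "b = \<beta> u"
  define m where "m = 4 / (conf (f u))\<^sup>2"
  have m: "m > 0" using c[OF U(4)] by (simp add: m_def)
  have b0: "b \<noteq> 0" using \<beta> by (simp add: b_def)
  have l: "linear ?f"
    using linear_frechet_derivative[OF smooth_on_imp_differentiable[OF U(3,4)]] .
  have f0: "?f a \<noteq> 0" if "a \<noteq> 0" for a
    using inj that linear_injective_0[OF l] by blast
  have surj: "surj ?f" using linear_injective_imp_surjective[OF l inj] by blast
  have g: "?g x y = m * ((b * cnj (?f x)) \<bullet> (b * cnj (?f y)))" for x y
    by (simp add: first_form_def dZ[OF U(4)] amb_tang_tang[OF c[OF U(4)]] m_def b_def)
  have g': "?g x y = m * (norm b)\<^sup>2 * (?f x \<bullet> ?f y)" for x y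
    unfolding g by (simp add: inner_complex_def cmod_power2) algebra
  have pos: "?g a a > 0" if "a \<noteq> 0" for a
    unfolding g' using m b0 f0[OF that] by simp
  show "a \<noteq> 0 \<Longrightarrow> ?g a a > 0" by (rule pos)
  have normal: "amb \<epsilon> (frechet_derivative Z (at w) a) (dir (f w)) = 0" if "w \<in> U" for w a
    using dZ[OF that] amb_tang_dir[OF c[OF that]] by simp
  have h: "second_form \<epsilon> Z u (dir (f u)) x y = - (m * ((b * cnj (?f y)) \<bullet> ?f x))" for x y
    using second_form_gauss[OF U(1,2,4) smooth_on_has_derivative[OF U(3,4)] c[OF U(4)] normal, of x y]
    by (simp add: dZ[OF U(4)] amb_tang_tang[OF c[OF U(4)]] m_def b_def)
  \<comment> \<open>Injectivity of the derivative of f makes the tangent plane all of the image of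
    \<open>tang\<close>; this leaves two unit normals, distinguished by \<sigma>.\<close>
  have sf: "\<exists>\<sigma>\<in>{1, -1}. \<forall>x y. second_form \<epsilon> Z u n x y = \<sigma> * (m * ((b * cnj (?f y)) \<bullet> ?f x))"
    if n: "unit_normal \<epsilon> Z u n" for n
  proof -
    have "amb \<epsilon> n (tang (f u) v) = 0" for v
    proof -
      obtain a where "?f a = cnj (v / b)" using surj unfolding surj_def by metis
      then have "frechet_derivative Z (at u) a = tang (f u) v"
        using b0 by (simp add: dZ[OF U(4)] b_def)
      then show ?thesis using n unfolding unit_normal_def by metis
    qed
    then have "n = dir (f u) \<or> n = - dir (f u)"
      using normal_vector_cases[OF c[OF U(4)]] n unfolding unit_normal_def by blast
    then show ?thesis
    proof
      assume "n = dir (f u)"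
      then show ?thesis using h by (intro bexI[of _ "-1"]) auto
    next
      assume "n = - dir (f u)"
      then have "second_form \<epsilon> Z u n x y = - second_form \<epsilon> Z u (dir (f u)) x y" for x y
        by (simp add: second_form_def amb_simps)
      then show ?thesis using h by (intro bexI[of _ "1"]) auto
    qed
  qed
  show "mean_curvature \<epsilon> Z u n = 0" if n: "unit_normal \<epsilon> Z u n"
  proof -
    obtain \<sigma> where \<sigma>: "\<And>x y. second_form \<epsilon> Z u n x y = \<sigma> * (m * ((b * cnj (?f y)) \<bullet> ?f x))"
      using sf[OF n] by blast
    \<comment> \<open>Up to a real factor the second form is Re (cnj b f'(x) f'(y)), the real part
      of a complex bilinear form in f', hence trace-free for a conformal metric.\<close>
    have "second_form \<epsilon> Z u n 1 1 * ?g \<i> \<i> - 2 * second_form \<epsilon> Z u n 1 \<i> * ?g 1 \<i>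
        + second_form \<epsilon> Z u n \<i> \<i> * ?g 1 1 = 0"
      unfolding \<sigma> g' by (simp add: inner_complex_def) algebra
    then show ?thesis
      using mean_curvature_zero_iff[OF smooth_on_imp_differentiable[OF U(2,4)] pos] by simp
  qed
  show "\<exists>k. second_form_eigenvalue \<epsilon> Z u n k \<and> k \<noteq> 0" if n: "unit_normal \<epsilon> Z u n"
  proof -
    obtain \<sigma> where \<sigma>: "\<sigma> = 1 \<or> \<sigma> = -1"
      "\<And>x y. second_form \<epsilon> Z u n x y = \<sigma> * (m * ((b * cnj (?f y)) \<bullet> ?f x))"
      using sf[OF n] by blast
    \<comment> \<open>\<open>v\<close> is fixed up to scale by the antilinear map \<open>x \<mapsto> b * cnj x\<close>.\<close>
    define v where "v = csqrt b"
    have v: "v * v = b" "v \<noteq> 0"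
      using b0 by (auto simp: v_def simp flip: power2_eq_square)
    obtain a where a: "?f a = v" using surj unfolding surj_def by metis
    have "a \<noteq> 0" using a v(2) linear_0[OF l] by auto
    moreover have "second_form \<epsilon> Z u n a y = \<sigma> / norm b * ?g a y" for y
    proof -
      have nb: "norm b = (norm v)\<^sup>2" using v(1) by (metis norm_mult power2_eq_square)
      have "(b * cnj (?f y)) \<bullet> v = (norm v)\<^sup>2 * (v \<bullet> ?f y)"
        unfolding v(1)[symmetric] by (simp add: inner_complex_def cmod_power2) algebra
      then show ?thesis
        unfolding \<sigma>(2) g' a nb using v(2) by (simp add: power2_eq_square)
    qed
    ultimately have "second_form_eigenvalue \<epsilon> Z u n (\<sigma> / norm b)"
      unfolding second_form_eigenvalue_def by blast
    moreover have "\<sigma> / norm b \<noteq> 0" using \<sigma>(1) b0 by auto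
    ultimately show ?thesis by blast
  qed
qed

text \<open>Every line carries one distinguished point, at the height given by a local section
  through it; L parametrises the surface of these points.\<close>

lemma minimal_surface_of_sections:
  assumes L: "embedded_surface L" "L \<subseteq> TN \<epsilon>" "lagrangian \<epsilon> L"
    and sections: "\<And>\<gamma>. \<gamma> \<in> L \<Longrightarrow> \<exists>W U F. open W \<and> \<gamma> \<in> W \<and> local_section \<epsilon> U F \<and> L \<inter> W = section_graph U F \<and>
      (\<forall>\<xi>\<in>U. minimal_equation F \<xi> \<and> wirt (\<lambda>w. cnj (F w)) \<xi> \<noteq> 0)"
  shows "\<exists>X. immersed_surface \<epsilon> L X \<and> zero_mean_curvature \<epsilon> L X \<and>
    (\<forall>p\<in>L. \<not> flat_point \<epsilon> L X p) \<and> orthogonal_to \<epsilon> L L X"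
proof -
  obtain W U F where *: "\<And>\<gamma>. \<gamma> \<in> L \<Longrightarrow> open (W \<gamma>) \<and> \<gamma> \<in> W \<gamma> \<and> local_section \<epsilon> (U \<gamma>) (F \<gamma>) \<and>
      L \<inter> W \<gamma> = section_graph (U \<gamma>) (F \<gamma>) \<and>
      (\<forall>\<xi>\<in>U \<gamma>. minimal_equation (F \<gamma>) \<xi> \<and> wirt (\<lambda>w. cnj (F \<gamma> w)) \<xi> \<noteq> 0)"
    using sections by metis
  have W: "open (W \<gamma>)" "\<gamma> \<in> W \<gamma>" "L \<inter> W \<gamma> = section_graph (U \<gamma>) (F \<gamma>)"
    and U: "open (U \<gamma>)" "U \<gamma> \<subseteq> N \<epsilon>" "smooth_on (U \<gamma>) (F \<gamma>)"
    and eq: "\<And>\<xi>. \<xi> \<in> U \<gamma> \<Longrightarrow> minimal_equation (F \<gamma>) \<xi>"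
    and nz: "\<And>\<xi>. \<xi> \<in> U \<gamma> \<Longrightarrow> wirt (\<lambda>w. cnj (F \<gamma> w)) \<xi> \<noteq> 0" if "\<gamma> \<in> L" for \<gamma>
    using *[OF that] unfolding local_section_def by auto
  define X where "X = (\<lambda>\<gamma>. line_point \<epsilon> \<gamma> (height (F \<gamma>) (fst \<gamma>)))"
  have c: "conf (fst \<gamma>) \<noteq> 0" if "\<gamma> \<in> L" for \<gamma>
    using L(2) that conf_ne by (fastforce simp: TN_def)
  have in_graph: "fst p \<in> U \<gamma>" "snd p = F \<gamma> (fst p)" if "\<gamma> \<in> L" "p \<in> L" "p \<in> W \<gamma>" for \<gamma> p
  proof -
    have "p \<in> section_graph (U \<gamma>) (F \<gamma>)" using W(3)[OF that(1)] that(2,3) by blast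
    then show "fst p \<in> U \<gamma>" "snd p = F \<gamma> (fst p)" by (auto simp: section_graph_def)
  qed
  \<comment> \<open>The sections chosen at p and at \<gamma> parametrise the same lines of L near p,
    so they agree on a neighbourhood of \<open>fst p\<close> and have equal Wirtinger derivatives
    there.\<close>
  have local_height: "height (F p) (fst p) = height (F \<gamma>) (fst p)"
    if \<gamma>: "\<gamma> \<in> L" and p: "p \<in> L" "p \<in> W \<gamma>" for \<gamma> p
  proof -
    let ?G = "\<lambda>w. (w, F p w)"
    define T where "T = U p \<inter> ?G -` W \<gamma>"
    have "continuous_on (U p) ?G"
      by (intro continuous_intros smooth_on_continuous[OF U(3)[OF p(1)]])
    then have T: "open T"
      unfolding T_def using continuous_open_preimage U(1)[OF p(1)] W(1)[OF \<gamma>] by blast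
    have pp: "fst p \<in> U p" "snd p = F p (fst p)"
      using in_graph[OF p(1) p(1) W(2)[OF p(1)]] .
    then have "?G (fst p) = p" by (simp add: prod_eq_iff)
    then have pT: "fst p \<in> T" using pp p(2) by (simp add: T_def)
    have FF: "F p w = F \<gamma> w" if "w \<in> T" for w
    proof -
      have "?G w \<in> L" using W(3)[OF p(1)] that by (auto simp: T_def section_graph_def)
      then show ?thesis using in_graph(2)[OF \<gamma>, of "?G w"] that by (simp add: T_def)
    qed
    show ?thesis
      unfolding height_def using wirt_cong[OF T pT FF] FF[OF pT] by simp
  qed
  have surface: "\<exists>U1. open U1 \<and> u \<in> U1 \<and> smooth_on U1 (X \<circ> \<phi>)"
    and first: "\<And>a. a \<noteq> 0 \<Longrightarrow> first_form \<epsilon> (X \<circ> \<phi>) u a a > 0"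
    and mean: "\<And>n. unit_normal \<epsilon> (X \<circ> \<phi>) u n \<Longrightarrow> mean_curvature \<epsilon> (X \<circ> \<phi>) u n = 0"
    and eigen: "\<And>n. unit_normal \<epsilon> (X \<circ> \<phi>) u n \<Longrightarrow> \<exists>k. second_form_eigenvalue \<epsilon> (X \<circ> \<phi>) u n k \<and> k \<noteq> 0"
    and orth: "\<And>a. amb \<epsilon> (frechet_derivative (X \<circ> \<phi>) (at u) a) (dir (fst (\<phi> u))) = 0"
    if \<phi>: "surface_chart L V \<phi>" and u: "u \<in> V" for V \<phi> u
  proof -
    define \<gamma> where "\<gamma> = \<phi> u"
    have V: "open V" "smooth_on V \<phi>" "inj (frechet_derivative \<phi> (at u))" "\<phi> ` V \<subseteq> L"
      using \<phi> u surface_chart_subset[OF \<phi>] unfolding surface_chart_def by auto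
    have \<gamma>: "\<gamma> \<in> L" using V(4) u by (auto simp: \<gamma>_def)
    \<comment> \<open>On this part of the chart X can be computed from the single section
      \<open>F \<gamma>\<close>, although its definition uses a different section at every
      line.\<close>
    define U1 where "U1 = V \<inter> \<phi> -` W \<gamma>"
    have U1: "open U1" "u \<in> U1" "U1 \<subseteq> V"
      using continuous_open_preimage[OF smooth_on_continuous[OF V(2)] V(1) W(1)[OF \<gamma>]] u W(2)[OF \<gamma>]
      by (auto simp: U1_def \<gamma>_def)
    define f where "f = (\<lambda>w. fst (\<phi> w))"
    let ?Y = "\<lambda>\<zeta>. tang \<zeta> (F \<gamma> \<zeta>) + height (F \<gamma>) \<zeta> *\<^sub>R dir \<zeta>"
    have inL: "\<phi> w \<in> L" "\<phi> w \<in> W \<gamma>" if "w \<in> U1" for w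
      using V(4) that by (auto simp: U1_def)
    have fU: "f w \<in> U \<gamma>" "\<phi> w = (f w, F \<gamma> (f w))" if "w \<in> U1" for w
      using in_graph[OF \<gamma> inL[OF that]] by (auto simp: f_def prod_eq_iff)
    have cf: "conf (f w) \<noteq> 0" if "w \<in> U1" for w
      using c[OF inL(1)[OF that]] by (simp add: f_def)
    have XY: "(X \<circ> \<phi>) w = ?Y (f w)" if w: "w \<in> U1" for w
      using local_height[OF \<gamma> inL[OF w]] fU(2)[OF w]
      by (simp add: X_def line_point_eq cf[OF w])
    have sf: "smooth_on U1 f"
      unfolding f_def by (intro smooth_intros U1 smooth_on_subset[OF V(2)])
    have sX: "smooth_on U1 (X \<circ> \<phi>)"
    proof (rule smooth_on_cong[OF U1(1)])
      show "smooth_on U1 (\<lambda>w. ?Y (f w))"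
        by (rule smooth_on_compose[OF U1(1) U(1)[OF \<gamma>] _ sf
              smooth_line_surface[OF U[OF \<gamma>] smooth_height[OF U[OF \<gamma>]]]]) (use fU in blast)
    qed (simp only: XY)
    have wF: "wirt (F \<gamma>) \<zeta> = 2 * of_real \<epsilon> * cnj \<zeta> * F \<gamma> \<zeta> / of_real (conf \<zeta>) - of_real (height (F \<gamma>) \<zeta>)"
      if "\<zeta> \<in> U \<gamma>" for \<zeta>
      by (rule lagrangian_section[OF L(3) U[OF \<gamma>] W(1,3)[OF \<gamma>] that])
    have dX: "frechet_derivative (X \<circ> \<phi>) (at w) a
        = tang (f w) (wirt_bar (F \<gamma>) (f w) * cnj (frechet_derivative f (at w) a))" if w: "w \<in> U1" for w a
    proof -
      have "((\<lambda>w. ?Y (f w)) has_derivative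
          (\<lambda>a. tang (f w) (wirt_bar (F \<gamma>) (f w) * cnj (frechet_derivative f (at w) a)))) (at w)"
        by (rule has_derivative_compose[OF smooth_on_has_derivative[OF sf w]
              minimal_surface_derivative[OF U[OF \<gamma>] wF eq[OF \<gamma> fU(1)[OF w]] fU(1)[OF w]]])
      then have "((X \<circ> \<phi>) has_derivative
          (\<lambda>a. tang (f w) (wirt_bar (F \<gamma>) (f w) * cnj (frechet_derivative f (at w) a)))) (at w)"
        by (rule has_derivative_transform_within_open[OF _ U1(1) w]) (simp only: XY)
      from frechet_derivative_eqI[OF this] show ?thesis by simp
    qed
    \<comment> \<open>Locally the chart is (f, F f), so a vector killed by the derivative of f is
      killed by that of the chart.\<close>
    have injf: "inj (frechet_derivative f (at u))"
    proof -
      note df = smooth_on_has_derivative[OF sf U1(2)]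
      have "((\<lambda>w. (f w, F \<gamma> (f w))) has_derivative (\<lambda>a. (frechet_derivative f (at u) a,
          frechet_derivative (F \<gamma>) (at (f u)) (frechet_derivative f (at u) a)))) (at u)"
        by (rule has_derivative_Pair[OF df has_derivative_compose[OF df
              smooth_on_has_derivative[OF U(3)[OF \<gamma>] fU(1)[OF U1(2)]]]])
      then have "(\<phi> has_derivative (\<lambda>a. (frechet_derivative f (at u) a,
          frechet_derivative (F \<gamma>) (at (f u)) (frechet_derivative f (at u) a)))) (at u)"
        by (rule has_derivative_transform_within_open[OF _ U1(1,2)]) (simp only: fU(2))
      note D = frechet_derivative_eqI[OF this]
      have i: "inj (\<lambda>a. (frechet_derivative f (at u) a,
          frechet_derivative (F \<gamma>) (at (f u)) (frechet_derivative f (at u) a)))"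
        using V(3) unfolding D .
      show ?thesis by (rule injI) (rule injD[OF i], simp)
    qed
    have bz: "wirt_bar (F \<gamma>) (f u) \<noteq> 0"
      using nz[OF \<gamma> fU(1)[OF U1(2)]]
        wirt_cnj[OF smooth_on_imp_differentiable[OF U(3)[OF \<gamma>] fU(1)[OF U1(2)]]] by simp
    show "\<exists>U1. open U1 \<and> u \<in> U1 \<and> smooth_on U1 (X \<circ> \<phi>)"
      using U1(1,2) sX by blast
    show "a \<noteq> 0 \<Longrightarrow> first_form \<epsilon> (X \<circ> \<phi>) u a a > 0" for a
      by (rule anticonformal_surface(1)[OF U1(1) sX sf U1(2) injf cf dX bz])
    show "unit_normal \<epsilon> (X \<circ> \<phi>) u n \<Longrightarrow> mean_curvature \<epsilon> (X \<circ> \<phi>) u n = 0" for n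
      by (rule anticonformal_surface(2)[OF U1(1) sX sf U1(2) injf cf dX bz])
    show "unit_normal \<epsilon> (X \<circ> \<phi>) u n \<Longrightarrow> \<exists>k. second_form_eigenvalue \<epsilon> (X \<circ> \<phi>) u n k \<and> k \<noteq> 0" for n
      by (rule anticonformal_surface(3)[OF U1(1) sX sf U1(2) injf cf dX bz])
    show "amb \<epsilon> (frechet_derivative (X \<circ> \<phi>) (at u) a) (dir (fst (\<phi> u))) = 0" for a
      using dX[OF U1(2)] amb_tang_dir[OF cf[OF U1(2)]] by (simp add: f_def)
  qed
  have "immersed_surface \<epsilon> L X"
    unfolding immersed_surface_def
  proof (intro conjI allI impI ballI L(1))
    fix V \<phi> assume \<phi>: "surface_chart L V \<phi>"
    show "smooth_on V (X \<circ> \<phi>)"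
      by (rule smooth_on_local) (rule surface[OF \<phi>])
    show "first_form \<epsilon> (X \<circ> \<phi>) u a a > 0" if "u \<in> V" "a \<noteq> 0" for u a
      by (rule first[OF \<phi> that])
  qed
  moreover have "zero_mean_curvature \<epsilon> L X"
    unfolding zero_mean_curvature_def using mean by blast
  moreover have "\<not> flat_point \<epsilon> L X p" for p
    unfolding flat_point_def using eigen by blast
  moreover have "orthogonal_to \<epsilon> L L X"
    unfolding orthogonal_to_def
  proof (intro exI[of _ "\<lambda>p. p"] conjI allI impI ballI)
    show "X p \<in> line_of \<epsilon> p" for p
      by (simp add: X_def line_of_def)
    fix V \<phi> u a p q
    assume \<phi>: "surface_chart L V \<phi>" "u \<in> V" and pq: "p \<in> line_of \<epsilon> (\<phi> u)" "q \<in> line_of \<epsilon> (\<phi> u)"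
    have "\<phi> u \<in> L" using surface_chart_subset[OF \<phi>(1)] \<phi>(2) by blast
    then obtain r where "p - q = r *\<^sub>R dir (fst (\<phi> u))"
      using pq line_point_diff[OF c] unfolding line_of_def by blast
    then show "amb \<epsilon> (p - q) (frechet_derivative (X \<circ> \<phi>) (at u) a) = 0"
      using orth[OF \<phi>] by (simp add: amb_simps amb_commute)
  qed auto
  ultimately show ?thesis by blast
qed

end

text \<open>Fixing the type of M costs no generality: \<open>section_of_minimal_surface\<close>
  treats a parameter surface in any Euclidean space, and the converse takes L itself.\<close>

theorem theorem5:
  fixes \<epsilon> :: real and L :: "(complex \<times> complex) set"
  assumes "\<epsilon> = 1 \<or> \<epsilon> = -1"
    and "lagrangian_congruence \<epsilon> L"
  shows
    "(\<exists>(M :: (complex \<times> complex) set) X.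
        immersed_surface \<epsilon> M X \<and> zero_mean_curvature \<epsilon> M X \<and>
        (\<forall>p\<in>M. \<not> flat_point \<epsilon> M X p) \<and> orthogonal_to \<epsilon> L M X)
     \<longleftrightarrow>
     (\<forall>\<gamma>\<in>L. \<exists>W U F. open W \<and> \<gamma> \<in> W \<and> local_section \<epsilon> U F \<and> L \<inter> W = section_graph U F \<and>
        (\<forall>\<xi>\<in>U.
           wirt_bar (\<lambda>\<zeta>. wirt (\<lambda>w. cnj (F w)) \<zeta> / (1 + of_real \<epsilon> * \<zeta> * cnj \<zeta>) ^ 2) \<xi> = 0 \<and>
           wirt (\<lambda>w. cnj (F w)) \<xi> \<noteq> 0))"
proof -
  interpret sign \<epsilon> by unfold_locales (rule assms(1))
  have L: "embedded_surface L" "L \<subseteq> TN \<epsilon>" "lagrangian \<epsilon> L"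
    using assms(2) unfolding lagrangian_congruence_def by auto
  show ?thesis
    unfolding minimal_equation_def[symmetric]
  proof
    assume "\<exists>(M :: (complex \<times> complex) set) X.
        immersed_surface \<epsilon> M X \<and> zero_mean_curvature \<epsilon> M X \<and>
        (\<forall>p\<in>M. \<not> flat_point \<epsilon> M X p) \<and> orthogonal_to \<epsilon> L M X"
    then obtain M :: "(complex \<times> complex) set" and X where
      "immersed_surface \<epsilon> M X" "zero_mean_curvature \<epsilon> M X"
      "\<forall>p\<in>M. \<not> flat_point \<epsilon> M X p" "orthogonal_to \<epsilon> L M X"
      by auto
    from section_of_minimal_surface[OF L(1,2) this]
    show "\<forall>\<gamma>\<in>L. \<exists>W U F. open W \<and> \<gamma> \<in> W \<and> local_section \<epsilon> U F \<and> L \<inter> W = section_graph U F \<and>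
        (\<forall>\<xi>\<in>U. minimal_equation F \<xi> \<and> wirt (\<lambda>w. cnj (F w)) \<xi> \<noteq> 0)"
      by (rule ballI)
  next
    assume sections: "\<forall>\<gamma>\<in>L. \<exists>W U F. open W \<and> \<gamma> \<in> W \<and> local_section \<epsilon> U F \<and>
        L \<inter> W = section_graph U F \<and>
        (\<forall>\<xi>\<in>U. minimal_equation F \<xi> \<and> wirt (\<lambda>w. cnj (F w)) \<xi> \<noteq> 0)"
    show "\<exists>(M :: (complex \<times> complex) set) X.
        immersed_surface \<epsilon> M X \<and> zero_mean_curvature \<epsilon> M X \<and>
        (\<forall>p\<in>M. \<not> flat_point \<epsilon> M X p) \<and> orthogonal_to \<epsilon> L M X"
      by (rule exI[of _ L], rule minimal_surface_of_sections[OF L bspec[OF sections]])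
  qed
qed

end
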